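(* Assume that $W$ satisfies (W-i), (W-ii) and (W-iii), and write $W(s)=\frac12s^2+N(s)$ for $s\in\mathbb{R}^+$. If, for some $\beta_0>0$, $$N'(s)\ge0\qquad\forall\, s\in(\beta_0,+\infty),$$ then the nonlinear Klein-Gordon equation $\partial_t^2\psi-\Delta\psi+W'(\psi)=0$ in $\mathbb{R}^n$ is of type ($\beta$).
   Context: Here $n\ge2$, and $W:\mathbb{C}\to\mathbb{R}$ has the form $W(\psi)=F(|\psi|)$ with $F:\mathbb{R}^+\to\mathbb{R}$ smooth; $W'(\psi)=F'(|\psi|)\psi/|\psi|$, and for $s\ge0$ one writes $W(s)=F(s)$. The assumptions are: (W-i) $W(s)\ge0$; (W-ii) $W(0)=W'(0)=0$, $W''(0)=1$; (W-iii) $\lambda_0:=\inf_{s>0}\frac{W(s)}{\frac12s^2}<1$. Type ($\beta$): for $W$ satisfying (W-i), (W-ii), (W-iii), the equation is of type ($\beta$) if there exists a constant $b>0$ such that any hylomorphic soliton $\psi(t,x)=u(x)e^{-i\omega t}$ satisfies $\|\psi(t,\cdot)\|_{L^\infty(\mathbb{R}^n)}\le b$ for all $t\in\mathbb{R}$. The phase space is $X=H^1(\mathbb{R}^n,\mathbb{C})\times L^2(\mathbb{R}^n,\mathbb{C})$ with states $\Psi=(\psi,\psi_t)$; the time evolution $U_t$ of the equation on $X$ is assumed to be defined for all $t\in\mathbb{R}$. Energy and hylomorphic charge are $\mathcal{E}(\Psi)=\int[\frac12|\psi_t|^2+\frac12|\nabla\psi|^2+W(\psi)]dx$ and $\mathcal{H}(\Psi)=\int\mathrm{Im}(\psi_t\overline\psi)\,dx$.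 Since $W''(0)=1$, the hylomorphy ratio is $\Lambda(\Psi)=\mathcal{E}(\Psi)/|\mathcal{H}(\Psi)|$. The barycenter of a state is $q_\Psi=\int x\,|\Psi|^2dx/\int|\Psi|^2dx$ (for states with $\int|x||\Psi|^2dx<\infty$). A state $\Psi$ is a solitary wave if for every $\varepsilon>0$ there is $R>0$ such that for all $t\in\mathbb{R}$, $\int|U_t\Psi|^2dx-\int_{B_R(q_\Psi(t))}|U_t\Psi|^2dx<\varepsilon$, where $q_\Psi(t)$ is the barycenter of $U_t\Psi$. An invariant set $G\subset X$ is stable if for every $\varepsilon>0$ there is $\delta>0$ such that $d(\Psi,G)<\delta$ implies $d(U_t\Psi,G)<\varepsilon$ for all $t\in\mathbb{R}$. A state $\Psi_0$ is orbitally stable if it belongs to a finite dimensional manifold $G\subset X$ that is invariant and stable. A soliton is an orbitally stable solitary wave $\Psi_0\neq0$; it is hylomorphic if $\Lambda(\Psi_0)<1$. A hylomorphic soliton of the form $\psi(t,x)=u(x)e^{-i\omega t}$ is a finite energy solution of the equation of this form, with $u\ge0$ and $u\in H^1(\mathbb{R}^n)$, whose state $(u,-i\omega u)\in X$ is a hylomorphic soliton. Without loss of generality the convention $\mathcal{H}<0$, $\omega>0$ is adopted. *)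

theory Defs
  imports "HOL-Probability.Probability"
begin

section \<open>The potential\<close>

text \<open>
  \<open>W \<psi> = F \<bar>\<psi>\<bar>\<close> with \<open>F\<close> smooth on \<open>[0, \<infinity>)\<close>.  Derivatives of \<open>F\<close> are taken within
  \<open>[0, \<infinity>)\<close>, hence are one-sided at \<open>0\<close>; the values of \<open>F\<close> on negative reals play no role.
\<close>

definition deriv_plus :: "(real \<Rightarrow> real) \<Rightarrow> real \<Rightarrow> real" where
  "deriv_plus f s = vector_derivative f (at s within {0..})"

definition smooth_plus :: "(real \<Rightarrow> real) \<Rightarrow> bool" where
  "smooth_plus f \<longleftrightarrow> (\<forall>k. \<forall>s\<ge>0. ((deriv_plus ^^ k) f) differentiable (at s within {0..}))"

definition potential :: "(real \<Rightarrow> real) \<Rightarrow> complex \<Rightarrow> real" where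
  "potential F \<psi> = F (cmod \<psi>)"

text \<open>At \<open>\<psi> = 0\<close> the value is \<open>0\<close>, in accordance with \<open>W'(0) = 0\<close>.\<close>

definition potential_deriv :: "(real \<Rightarrow> real) \<Rightarrow> complex \<Rightarrow> complex" where
  "potential_deriv F \<psi> = of_real (deriv_plus F (cmod \<psi>)) * \<psi> / of_real (cmod \<psi>)"

definition W_i :: "(real \<Rightarrow> real) \<Rightarrow> bool" where
  "W_i F \<longleftrightarrow> (\<forall>s\<ge>0. F s \<ge> 0)"

definition W_ii :: "(real \<Rightarrow> real) \<Rightarrow> bool" where
  "W_ii F \<longleftrightarrow> F 0 = 0 \<and> deriv_plus F 0 = 0 \<and> deriv_plus (deriv_plus F) 0 = 1"

definition W_iii :: "(real \<Rightarrow> real) \<Rightarrow> bool" where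
  "W_iii F \<longleftrightarrow> (INF s\<in>{0<..}. F s / (1/2 * s\<^sup>2)) < 1"

definition nonlinear_part :: "(real \<Rightarrow> real) \<Rightarrow> real \<Rightarrow> real" where
  "nonlinear_part F s = F s - 1/2 * s\<^sup>2"


section \<open>Test functions\<close>

definition partial :: "'n \<Rightarrow> (real^'n::finite \<Rightarrow> real) \<Rightarrow> real^'n \<Rightarrow> real" where
  "partial i \<phi> x = frechet_derivative \<phi> (at x) (axis i 1)"

coinductive smooth :: "(real^'n::finite \<Rightarrow> real) \<Rightarrow> bool" where
  "(\<And>x. \<phi> differentiable (at x)) \<Longrightarrow> (\<And>i. smooth (partial i \<phi>)) \<Longrightarrow> smooth \<phi>"

definition test_function :: "(real^'n::finite \<Rightarrow> real) \<Rightarrow> bool" where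
  "test_function \<phi> \<longleftrightarrow> smooth \<phi> \<and> compact (closure {x. \<phi> x \<noteq> 0})"

definition laplacian :: "(real^'n::finite \<Rightarrow> real) \<Rightarrow> real^'n \<Rightarrow> real" where
  "laplacian \<phi> x = (\<Sum>i\<in>UNIV. partial i (partial i \<phi>) x)"


section \<open>The spaces \<open>L\<^sup>2(\<real>\<^sup>n, \<complex>)\<close> and \<open>H\<^sup>1(\<real>\<^sup>n, \<complex>)\<close>\<close>

definition square_integrable :: "(real^'n::finite \<Rightarrow> 'b::{real_normed_vector,second_countable_topology}) \<Rightarrow> bool" where
  "square_integrable f \<longleftrightarrow> f \<in> borel_measurable lborel \<and> integrable lborel (\<lambda>x. (norm (f x))\<^sup>2)"

definition L2_rel :: "(real^'n::finite \<Rightarrow> complex) \<Rightarrow> (real^'n \<Rightarrow> complex) \<Rightarrow> bool" where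
  "L2_rel f g \<longleftrightarrow> square_integrable f \<and> square_integrable g \<and> (AE x in lborel. f x = g x)"

text \<open>
  Elements of type \<open>'n L2\<close> are classes modulo equality almost everywhere; \<open>rep_L2\<close> selects a
  (square integrable, Borel) representative.
\<close>

quotient_type (overloaded) 'n L2 =
  "(real^'n::finite) \<Rightarrow> complex" / partial: L2_rel
  morphisms rep_L2 abs_L2
proof (rule part_equivpI)
  show "\<exists>f::real^'n \<Rightarrow> complex. L2_rel f f"
    by (rule exI[of _ "\<lambda>_. 0"]) (simp add: L2_rel_def square_integrable_def)
  show "symp (L2_rel :: (real^'n \<Rightarrow> complex) \<Rightarrow> _)"
    by (auto simp: symp_def L2_rel_def elim: AE_mp)
  show "transp (L2_rel :: (real^'n \<Rightarrow> complex) \<Rightarrow> _)"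
    unfolding transp_def L2_rel_def by fastforce
qed

lemma rep_L2_square_integrable: "square_integrable (rep_L2 \<psi>)"
  using Quotient3_rel_rep[OF Quotient3_L2, of \<psi> \<psi>] by (simp add: L2_rel_def)

lemma L2_eqI: "(AE x in lborel. rep_L2 \<psi> x = rep_L2 \<phi> x) \<Longrightarrow> \<psi> = \<phi>"
  using Quotient3_rel_rep[OF Quotient3_L2, of \<psi> \<phi>] rep_L2_square_integrable
  by (auto simp: L2_rel_def)

lemma rep_abs_L2:
  assumes "square_integrable f"
  shows "AE x in lborel. rep_L2 (abs_L2 f) x = f x"
proof -
  have "L2_rel (rep_L2 (abs_L2 f)) f"
    by (rule Quotient3_rep_abs[OF Quotient3_L2]) (use assms in \<open>simp add: L2_rel_def\<close>)
  then show ?thesis by (simp add: L2_rel_def)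
qed

definition cscale :: "complex \<Rightarrow> 'n::finite L2 \<Rightarrow> 'n L2" where
  "cscale c \<psi> = abs_L2 (\<lambda>x. c * rep_L2 \<psi> x)"

definition weak_gradient :: "'n::finite L2 \<Rightarrow> (real^'n \<Rightarrow> complex^'n) \<Rightarrow> bool" where
  "weak_gradient \<psi> g \<longleftrightarrow> square_integrable g \<and>
     (\<forall>\<phi> i. test_function \<phi> \<longrightarrow>
        (LINT x|lborel. partial i \<phi> x *\<^sub>R rep_L2 \<psi> x) = - (LINT x|lborel. \<phi> x *\<^sub>R (g x $ i)))"

definition H1 :: "'n::finite L2 set" where
  "H1 = {\<psi>. \<exists>g. weak_gradient \<psi> g}"

definition grad :: "'n::finite L2 \<Rightarrow> real^'n \<Rightarrow> complex^'n" where
  "grad \<psi> = (SOME g. weak_gradient \<psi> g)"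

lemma weak_gradient_grad: "\<psi> \<in> H1 \<Longrightarrow> weak_gradient \<psi> (grad \<psi>)"
  unfolding H1_def grad_def mem_Collect_eq by (erule someI_ex[of "weak_gradient \<psi>"])

definition Linf_norm :: "'n::finite L2 \<Rightarrow> ereal" where
  "Linf_norm \<psi> = esssup lborel (\<lambda>x. ereal (cmod (rep_L2 \<psi> x)))"


section \<open>The phase space\<close>

type_synonym 'n state = "'n L2 \<times> 'n L2"

definition phase_space :: "'n::finite state set" where
  "phase_space = H1 \<times> UNIV"

definition phase_dist :: "'n::finite state \<Rightarrow> 'n state \<Rightarrow> real" where
  "phase_dist \<Psi> \<Phi> = sqrt (LINT x|lborel.
      (cmod (rep_L2 (fst \<Psi>) x - rep_L2 (fst \<Phi>) x))\<^sup>2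
    + (norm (grad (fst \<Psi>) x - grad (fst \<Phi>) x))\<^sup>2
    + (cmod (rep_L2 (snd \<Psi>) x - rep_L2 (snd \<Phi>) x))\<^sup>2)"

lemma square_integrable_diff:
  assumes "square_integrable f" "square_integrable g"
  shows "square_integrable (\<lambda>x. f x - g x)"
proof -
  have [measurable]: "f \<in> borel_measurable lborel" "g \<in> borel_measurable lborel"
    using assms by (auto simp: square_integrable_def)
  have "integrable lborel (\<lambda>x. (norm (f x - g x))\<^sup>2)"
  proof (rule Bochner_Integration.integrable_bound)
    show "integrable lborel (\<lambda>x. 2 * (norm (f x))\<^sup>2 + 2 * (norm (g x))\<^sup>2)"
      using assms by (auto simp: square_integrable_def)
    have "(norm (f x - g x))\<^sup>2 \<le> 2 * (norm (f x))\<^sup>2 + 2 * (norm (g x))\<^sup>2" for x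
    proof -
      have "(norm (f x - g x))\<^sup>2 \<le> (norm (f x) + norm (g x))\<^sup>2"
        by (intro power_mono norm_triangle_ineq4) auto
      also have "\<dots> \<le> 2 * (norm (f x))\<^sup>2 + 2 * (norm (g x))\<^sup>2"
        using zero_le_power2[of "norm (f x) - norm (g x)"]
        by (simp add: power2_eq_square algebra_simps)
      finally show ?thesis .
    qed
    then show "AE x in lborel. norm ((norm (f x - g x))\<^sup>2)
        \<le> norm (2 * (norm (f x))\<^sup>2 + 2 * (norm (g x))\<^sup>2)"
      by (auto intro!: AE_I2 order_trans[OF _ abs_ge_self])
  qed measurable
  then show ?thesis by (simp add: square_integrable_def)
qed

lemma Minkowski_L2:
  fixes f g :: "'a \<Rightarrow> real"
  assumes [measurable]: "f \<in> borel_measurable M" "g \<in> borel_measurable M"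
    and f: "integrable M (\<lambda>x. (f x)\<^sup>2)" and g: "integrable M (\<lambda>x. (g x)\<^sup>2)"
  shows "integrable M (\<lambda>x. (f x + g x)\<^sup>2)"
    and "sqrt (LINT x|M. (f x + g x)\<^sup>2) \<le> sqrt (LINT x|M. (f x)\<^sup>2) + sqrt (LINT x|M. (g x)\<^sup>2)"
proof -
  define A where "A = sqrt (LINT x|M. (f x)\<^sup>2)"
  define B where "B = sqrt (LINT x|M. (g x)\<^sup>2)"
  have A: "A \<ge> 0" "A\<^sup>2 = (LINT x|M. (f x)\<^sup>2)" and B: "B \<ge> 0" "B\<^sup>2 = (LINT x|M. (g x)\<^sup>2)"
    by (auto simp: A_def B_def)
  have fg: "integrable M (\<lambda>x. f x * g x)"
  proof (rule Bochner_Integration.integrable_bound)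
    show "integrable M (\<lambda>x. (f x)\<^sup>2 + (g x)\<^sup>2)" using f g by auto
    have "\<bar>f x * g x\<bar> \<le> (f x)\<^sup>2 + (g x)\<^sup>2" for x
      using zero_le_power2[of "\<bar>f x\<bar> - \<bar>g x\<bar>"] zero_le_power2[of "f x"] zero_le_power2[of "g x"]
        mult_nonneg_nonneg[OF abs_ge_zero[of "f x"] abs_ge_zero[of "g x"]]
      unfolding power2_diff power2_abs abs_mult by linarith
    then show "AE x in M. norm (f x * g x) \<le> norm ((f x)\<^sup>2 + (g x)\<^sup>2)"
      by auto
  qed measurable
  show "integrable M (\<lambda>x. (f x + g x)\<^sup>2)"
    unfolding power2_sum using f g fg by (auto simp: mult.assoc)
  have eq: "(LINT x|M. (f x + g x)\<^sup>2) = A\<^sup>2 + B\<^sup>2 + 2 * (LINT x|M. f x * g x)"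
    unfolding power2_sum A B using f g fg by (simp add: mult.assoc)
  have le: "(LINT x|M. f x * g x) \<le> A * B"
  proof (cases "A = 0 \<or> B = 0")
    case True
    then have "(AE x in M. (f x)\<^sup>2 = 0) \<or> (AE x in M. (g x)\<^sup>2 = 0)"
      using integral_nonneg_eq_0_iff_AE[OF f] integral_nonneg_eq_0_iff_AE[OF g] A B by auto
    then have "AE x in M. f x * g x = 0" by (auto elim: AE_mp)
    then have "(LINT x|M. f x * g x) = 0" by (rule integral_eq_zero_AE)
    then show ?thesis using A B by simp
  next
    case False
    then have pos: "A * B > 0" using A B by simp
    have "0 \<le> (LINT x|M. (B * f x - A * g x)\<^sup>2)" by simp
    also have "\<dots> = (LINT x|M. B\<^sup>2 * (f x)\<^sup>2 + A\<^sup>2 * (g x)\<^sup>2 - 2 * A * B * (f x * g x))"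
      by (intro Bochner_Integration.integral_cong) (auto simp: power2_eq_square algebra_simps)
    also have "\<dots> = B\<^sup>2 * A\<^sup>2 + A\<^sup>2 * B\<^sup>2 - 2 * A * B * (LINT x|M. f x * g x)"
      unfolding A B using f g fg by simp
    finally have "(A * B) * (LINT x|M. f x * g x) \<le> (A * B) * (A * B)"
      by (simp add: power2_eq_square algebra_simps)
    then show ?thesis using pos by (metis mult_le_cancel_left_pos)
  qed
  have "(LINT x|M. (f x + g x)\<^sup>2) \<le> (A + B)\<^sup>2"
    using eq le by (simp add: power2_sum)
  then show "sqrt (LINT x|M. (f x + g x)\<^sup>2)
      \<le> sqrt (LINT x|M. (f x)\<^sup>2) + sqrt (LINT x|M. (g x)\<^sup>2)"
    using A B by (metis A_def B_def add_nonneg_nonneg real_sqrt_le_iff real_sqrt_unique)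
qed

interpretation phase_space: Metric_space "phase_space :: 'n::finite state set" phase_dist
proof
  fix \<Psi> \<Phi> :: "'n state"
  show "0 \<le> phase_dist \<Psi> \<Phi>" by (simp add: phase_dist_def)
  show "phase_dist \<Psi> \<Phi> = phase_dist \<Phi> \<Psi>" by (simp add: phase_dist_def norm_minus_commute)
next
  define J where "J \<equiv> \<lambda>(\<Psi> :: 'n state) x. (rep_L2 (fst \<Psi>) x, grad (fst \<Psi>) x, rep_L2 (snd \<Psi>) x)"
  define N where "N \<equiv> \<lambda>(\<Psi> :: 'n state) \<Phi> x. norm (J \<Psi> x - J \<Phi> x)"
  have N2: "(N \<Psi> \<Phi> x)\<^sup>2 = (cmod (rep_L2 (fst \<Psi>) x - rep_L2 (fst \<Phi>) x))\<^sup>2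
    + (norm (grad (fst \<Psi>) x - grad (fst \<Phi>) x))\<^sup>2
    + (cmod (rep_L2 (snd \<Psi>) x - rep_L2 (snd \<Phi>) x))\<^sup>2" for \<Psi> \<Phi> x
    by (simp add: N_def J_def norm_Pair)
  have dist: "phase_dist \<Psi> \<Phi> = sqrt (LINT x|lborel. (N \<Psi> \<Phi> x)\<^sup>2)" for \<Psi> \<Phi>
    unfolding phase_dist_def N2 ..
  have grad: "square_integrable (grad (fst \<Psi>))" if "\<Psi> \<in> phase_space" for \<Psi> :: "'n state"
    using that weak_gradient_grad[of "fst \<Psi>"]
    by (auto simp: phase_space_def weak_gradient_def)
  have N: "N \<Psi> \<Phi> \<in> borel_measurable lborel" "integrable lborel (\<lambda>x. (N \<Psi> \<Phi> x)\<^sup>2)"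
    if "\<Psi> \<in> phase_space" "\<Phi> \<in> phase_space" for \<Psi> \<Phi>
  proof -
    have s: "square_integrable (\<lambda>x. rep_L2 (fst \<Psi>) x - rep_L2 (fst \<Phi>) x)"
      "square_integrable (\<lambda>x. grad (fst \<Psi>) x - grad (fst \<Phi>) x)"
      "square_integrable (\<lambda>x. rep_L2 (snd \<Psi>) x - rep_L2 (snd \<Phi>) x)"
      using that by (auto intro!: square_integrable_diff rep_L2_square_integrable grad)
    show i: "integrable lborel (\<lambda>x. (N \<Psi> \<Phi> x)\<^sup>2)"
      unfolding N2 using s by (auto simp: square_integrable_def)
    have "(\<lambda>x. sqrt ((N \<Psi> \<Phi> x)\<^sup>2)) \<in> borel_measurable lborel"
      using borel_measurable_integrable[OF i] by measurable
    then show "N \<Psi> \<Phi> \<in> borel_measurable lborel" by (simp add: N_def)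
  qed
  fix \<Psi> \<Phi> \<Xi> :: "'n state"
  assume m: "\<Psi> \<in> phase_space" "\<Phi> \<in> phase_space"
  show "phase_dist \<Psi> \<Phi> = 0 \<longleftrightarrow> \<Psi> = \<Phi>"
  proof
    assume "phase_dist \<Psi> \<Phi> = 0"
    then have "AE x in lborel. (N \<Psi> \<Phi> x)\<^sup>2 = 0"
      using integral_nonneg_eq_0_iff_AE[OF N(2)[OF m]] by (simp add: dist)
    then have "AE x in lborel. rep_L2 (fst \<Psi>) x = rep_L2 (fst \<Phi>) x \<and> rep_L2 (snd \<Psi>) x = rep_L2 (snd \<Phi>) x"
      by (rule AE_mp) (auto simp: N_def J_def zero_prod_def)
    then show "\<Psi> = \<Phi>" by (auto simp: prod_eq_iff intro!: L2_eqI elim: AE_mp)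
  qed (simp add: phase_dist_def)
  assume "\<Xi> \<in> phase_space"
  note m = m this
  have "phase_dist \<Psi> \<Xi> \<le> sqrt (LINT x|lborel. (N \<Psi> \<Phi> x + N \<Phi> \<Xi> x)\<^sup>2)"
    unfolding dist
  proof (intro real_sqrt_le_mono integral_mono power_mono)
    fix x
    show "N \<Psi> \<Xi> x \<le> N \<Psi> \<Phi> x + N \<Phi> \<Xi> x"
      unfolding N_def using norm_diff_triangle_ineq[of "J \<Psi> x" "J \<Phi> x" "J \<Phi> x" "J \<Xi> x"]
      by (metis dist_norm dist_triangle)
    show "0 \<le> N \<Psi> \<Xi> x" by (simp add: N_def)
  qed (intro Minkowski_L2 N m)+
  also have "\<dots> \<le> phase_dist \<Psi> \<Phi> + phase_dist \<Phi> \<Xi>"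
    unfolding dist by (intro Minkowski_L2 N m)
  finally show "phase_dist \<Psi> \<Xi> \<le> phase_dist \<Psi> \<Phi> + phase_dist \<Phi> \<Xi>" .
qed

abbreviation phase_topology :: "'n::finite state topology" where
  "phase_topology \<equiv> Metric_space.mtopology phase_space phase_dist"

definition set_dist :: "'n::finite state \<Rightarrow> 'n state set \<Rightarrow> real" where
  "set_dist \<Psi> G = (INF \<Phi>\<in>G. phase_dist \<Psi> \<Phi>)"

definition zero_state :: "'n::finite state" where
  "zero_state = (abs_L2 (\<lambda>_. 0), abs_L2 (\<lambda>_. 0))"

definition density :: "'n::finite state \<Rightarrow> real^'n \<Rightarrow> real" where
  "density \<Psi> x = (cmod (rep_L2 (fst \<Psi>) x))\<^sup>2 + (cmod (rep_L2 (snd \<Psi>) x))\<^sup>2"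

definition energy_density :: "(real \<Rightarrow> real) \<Rightarrow> 'n::finite state \<Rightarrow> real^'n \<Rightarrow> real" where
  "energy_density F \<Psi> x =
     1/2 * (cmod (rep_L2 (snd \<Psi>) x))\<^sup>2 + 1/2 * (norm (grad (fst \<Psi>) x))\<^sup>2
     + potential F (rep_L2 (fst \<Psi>) x)"

text \<open>
  For nonnegative \<open>W\<close> the energy of a state of the phase space is infinite exactly if its density
  is not integrable; \<open>energy\<close> is only meaningful under \<open>finite_energy\<close>.
\<close>

definition finite_energy :: "(real \<Rightarrow> real) \<Rightarrow> 'n::finite state \<Rightarrow> bool" where
  "finite_energy F \<Psi> \<longleftrightarrow> integrable lborel (energy_density F \<Psi>)"

definition energy :: "(real \<Rightarrow> real) \<Rightarrow> 'n::finite state \<Rightarrow> real" where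
  "energy F \<Psi> = (LINT x|lborel. energy_density F \<Psi> x)"

definition charge :: "'n::finite state \<Rightarrow> real" where
  "charge \<Psi> = (LINT x|lborel. Im (rep_L2 (snd \<Psi>) x * cnj (rep_L2 (fst \<Psi>) x)))"

definition hylomorphy_ratio :: "(real \<Rightarrow> real) \<Rightarrow> 'n::finite state \<Rightarrow> real" where
  "hylomorphy_ratio F \<Psi> = energy F \<Psi> / \<bar>charge \<Psi>\<bar>"


section \<open>The nonlinear Klein-Gordon equation and its time evolution\<close>

definition pairing :: "(real^'n::finite \<Rightarrow> complex) \<Rightarrow> (real^'n \<Rightarrow> real) \<Rightarrow> complex" where
  "pairing f \<phi> = (LINT x|lborel. \<phi> x *\<^sub>R f x)"

definition locally_integrable :: "(real^'n::finite \<Rightarrow> complex) \<Rightarrow> bool" where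
  "locally_integrable f \<longleftrightarrow> (\<forall>K. compact K \<longrightarrow> set_integrable lborel K f)"

text \<open>
  Weak solutions: a curve \<open>t \<mapsto> (\<psi>(t), \<psi>\<^sub>t(t))\<close> that is continuous in the phase space and solves
  the first order system \<open>\<partial>\<^sub>t \<psi> = \<psi>\<^sub>t\<close>, \<open>\<partial>\<^sub>t \<psi>\<^sub>t = \<Delta>\<psi> - W'(\<psi>)\<close> in the sense of distributions,
  written in time-integrated form.
\<close>

definition nkg_solution :: "(real \<Rightarrow> real) \<Rightarrow> (real \<Rightarrow> 'n::finite state) \<Rightarrow> bool" where
  "nkg_solution F \<Psi> \<longleftrightarrow>
     continuous_map euclidean phase_topology \<Psi> \<and>
     (AE t in lborel. locally_integrable (\<lambda>x. potential_deriv F (rep_L2 (fst (\<Psi> t)) x))) \<and>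
     (\<forall>\<phi> a b. test_function \<phi> \<and> a \<le> b \<longrightarrow>
        has_bochner_integral (lebesgue_on {a..b})
          (\<lambda>t. pairing (rep_L2 (snd (\<Psi> t))) \<phi>)
          (pairing (rep_L2 (fst (\<Psi> b))) \<phi> - pairing (rep_L2 (fst (\<Psi> a))) \<phi>) \<and>
        has_bochner_integral (lebesgue_on {a..b})
          (\<lambda>t. pairing (rep_L2 (fst (\<Psi> t))) (laplacian \<phi>)
               - pairing (\<lambda>x. potential_deriv F (rep_L2 (fst (\<Psi> t)) x)) \<phi>)
          (pairing (rep_L2 (snd (\<Psi> b))) \<phi> - pairing (rep_L2 (snd (\<Psi> a))) \<phi>))"

definition time_evolution :: "(real \<Rightarrow> real) \<Rightarrow> (real \<Rightarrow> 'n::finite state \<Rightarrow> 'n state) \<Rightarrow> bool" where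
  "time_evolution F U \<longleftrightarrow>
     (\<forall>\<Psi>\<in>phase_space.
        U 0 \<Psi> = \<Psi> \<and>
        (\<forall>t. U t \<Psi> \<in> phase_space) \<and>
        (\<forall>s t. U (s + t) \<Psi> = U s (U t \<Psi>)) \<and>
        nkg_solution F (\<lambda>t. U t \<Psi>))"


section \<open>Hylomorphic solitons\<close>

definition finite_moment :: "'n::finite state \<Rightarrow> bool" where
  "finite_moment \<Psi> \<longleftrightarrow> integrable lborel (\<lambda>x. norm x * density \<Psi> x)"

definition barycenter :: "'n::finite state \<Rightarrow> real^'n" where
  "barycenter \<Psi> = (LINT x|lborel. density \<Psi> x *\<^sub>R x) /\<^sub>R (LINT x|lborel. density \<Psi> x)"

definition solitary_wave :: "(real \<Rightarrow> 'n::finite state \<Rightarrow> 'n state) \<Rightarrow> 'n state \<Rightarrow> bool" where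
  "solitary_wave U \<Psi> \<longleftrightarrow> \<Psi> \<in> phase_space \<and>
     (\<forall>t. finite_moment (U t \<Psi>)) \<and>
     (\<forall>\<epsilon>>0. \<exists>R>0. \<forall>t.
        (LINT x|lborel. density (U t \<Psi>) x)
        - (LINT x:ball (barycenter (U t \<Psi>)) R|lborel. density (U t \<Psi>) x) < \<epsilon>)"

definition invariant_set :: "(real \<Rightarrow> 'n::finite state \<Rightarrow> 'n state) \<Rightarrow> 'n state set \<Rightarrow> bool" where
  "invariant_set U G \<longleftrightarrow> (\<forall>t. \<forall>\<Psi>\<in>G. U t \<Psi> \<in> G)"

definition stable_set :: "(real \<Rightarrow> 'n::finite state \<Rightarrow> 'n state) \<Rightarrow> 'n state set \<Rightarrow> bool" where
  "stable_set U G \<longleftrightarrow>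
     (\<forall>\<epsilon>>0. \<exists>\<delta>>0. \<forall>\<Psi>\<in>phase_space. set_dist \<Psi> G < \<delta> \<longrightarrow> (\<forall>t. set_dist (U t \<Psi>) G < \<epsilon>))"

text \<open>
  A subset of the phase space that is, in the induced topology, a topological manifold of some
  finite dimension \<open>k\<close>.  (Hausdorff and second countable come for free, the phase space being a
  separable metric space.)
\<close>

definition finite_dim_manifold :: "'n::finite state set \<Rightarrow> bool" where
  "finite_dim_manifold G \<longleftrightarrow> G \<subseteq> phase_space \<and>
     (\<exists>k. \<forall>\<Psi>\<in>G. \<exists>V V'. \<Psi> \<in> V \<and> openin (subtopology phase_topology G) V \<and>
        openin (Euclidean_space k) V' \<and>
        subtopology phase_topology V homeomorphic_space subtopology (Euclidean_space k) V')"

definition orbitally_stable :: "(real \<Rightarrow> 'n::finite state \<Rightarrow> 'n state) \<Rightarrow> 'n state \<Rightarrow> bool" where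
  "orbitally_stable U \<Psi> \<longleftrightarrow>
     (\<exists>G. \<Psi> \<in> G \<and> finite_dim_manifold G \<and> invariant_set U G \<and> stable_set U G)"

definition soliton :: "(real \<Rightarrow> 'n::finite state \<Rightarrow> 'n state) \<Rightarrow> 'n state \<Rightarrow> bool" where
  "soliton U \<Psi> \<longleftrightarrow> solitary_wave U \<Psi> \<and> orbitally_stable U \<Psi> \<and> \<Psi> \<noteq> zero_state"

text \<open>
  \<open>\<Lambda>(\<Psi>) < 1\<close> is meant to include that \<open>\<Lambda>(\<Psi>)\<close> is defined: the energy is finite and the charge
  does not vanish (recall \<open>x / 0 = 0\<close>).
\<close>

definition hylomorphic_soliton ::
    "(real \<Rightarrow> real) \<Rightarrow> (real \<Rightarrow> 'n::finite state \<Rightarrow> 'n state) \<Rightarrow> 'n state \<Rightarrow> bool" where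
  "hylomorphic_soliton F U \<Psi> \<longleftrightarrow>
     soliton U \<Psi> \<and> finite_energy F \<Psi> \<and> charge \<Psi> \<noteq> 0 \<and> hylomorphy_ratio F \<Psi> < 1"

text \<open>The curve of states belonging to \<open>\<psi>(t, x) = u(x) exp (- \<i> \<omega> t)\<close>.\<close>

definition standing_wave :: "'n::finite L2 \<Rightarrow> real \<Rightarrow> real \<Rightarrow> 'n state" where
  "standing_wave u \<omega> t =
     (cscale (exp (- \<i> * \<omega> * t)) u, cscale (- \<i> * \<omega> * exp (- \<i> * \<omega> * t)) u)"

text \<open>
  The state \<open>(u, - \<i> \<omega> u)\<close> has charge \<open>- \<omega> \<integral> u\<^sup>2\<close>, so \<open>\<omega> > 0\<close> is the sign convention of a
  negative charge.
\<close>

definition hylomorphic_standing_wave ::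
    "(real \<Rightarrow> real) \<Rightarrow> (real \<Rightarrow> 'n::finite state \<Rightarrow> 'n state) \<Rightarrow> 'n L2 \<Rightarrow> real \<Rightarrow> bool" where
  "hylomorphic_standing_wave F U u \<omega> \<longleftrightarrow>
     u \<in> H1 \<and> (AE x in lborel. rep_L2 u x \<in> \<real>\<^sub>\<ge>\<^sub>0) \<and> \<omega> > 0 \<and>
     nkg_solution F (standing_wave u \<omega>) \<and> (\<forall>t. finite_energy F (standing_wave u \<omega> t)) \<and>
     hylomorphic_soliton F U (u, cscale (- \<i> * \<omega>) u)"

definition type_beta :: "(real \<Rightarrow> real) \<Rightarrow> (real \<Rightarrow> 'n::finite state \<Rightarrow> 'n state) \<Rightarrow> bool" where
  "type_beta F U \<longleftrightarrow>
     (\<exists>b>0. \<forall>u \<omega>. hylomorphic_standing_wave F U u \<omega> \<longrightarrow>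
        (\<forall>t. Linf_norm (fst (standing_wave u \<omega> t)) \<le> ereal b))"

end

theory Submission
  imports Defs
begin

text \<open>
  A standing wave with profile \<open>u \<ge> 0\<close> solves \<open>\<Delta>u = g\<close> in the sense of distributions, where
  \<open>g = W'(u) - \<omega>\<^sup>2 u\<close>.  With \<open>\<rho>\<^sub>r\<close> a radial bump at scale \<open>r\<close> one has \<open>\<partial>\<^sub>r \<rho>\<^sub>r = \<Delta>\<Phi>\<^sub>r\<close> for a test
  function \<open>0 \<le> \<Phi>\<^sub>r \<le> r \<rho>\<^sub>r / 2\<close>, so the means \<open>m(r) = \<integral> u \<rho>\<^sub>r\<close> satisfy \<open>m'(r) = \<integral> g \<Phi>\<^sub>r\<close>.  As
  \<open>g \<ge> - K u\<close>, the function \<open>m(r) exp (K r\<^sup>2 / 4)\<close> is nondecreasing; hence \<open>u\<close> is bounded by its means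
  at scale 1, and it is bounded and tends to \<open>0\<close> at infinity because \<open>u \<in> L\<^sup>2\<close>.  Then also
  \<open>g \<le> K u\<close>, the reverse monotonicity holds, and \<open>u\<close> is continuous.

  If \<open>\<omega> > 1\<close>, then \<open>- \<Delta>u \<ge> \<epsilon> u\<close> far out, where \<open>u\<close> is small.  This forces \<open>u = 0\<close> on large balls
  (whose first Dirichlet eigenvalue is below \<open>\<epsilon>\<close>), and then everywhere by the monotonicity of the means.
  If \<open>\<omega> \<le> 1\<close>, then \<open>\<Delta>u \<ge> N'(u) \<ge> 0\<close> where \<open>u > \<beta>\<^sub>0\<close>, and the maximum principle gives \<open>u \<le> \<beta>\<^sub>0\<close>.
  In both cases \<open>b = \<beta>\<^sub>0\<close> works.
\<close>

section \<open>Bump functions as test functions\<close>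

text \<open>The factor \<open>1 / s ^ k\<close> is what differentiating \<open>exp (- 1 / s)\<close>
  produces, so the family over all \<open>k\<close> is closed under derivatives up to linear
  combinations.\<close>

definition bump :: "nat \<Rightarrow> real \<Rightarrow> real" where
  "bump k s = (if s > 0 then exp (- 1 / s) / s ^ k else 0)"

lemma bump_nonneg: "bump k s \<ge> 0"
  by (simp add: bump_def)

lemma bump_pos: "s > 0 \<Longrightarrow> bump k s > 0"
  by (simp add: bump_def)

lemma bump_eq_0: "s \<le> 0 \<Longrightarrow> bump k s = 0"
  by (simp add: bump_def)

lemma bump_shift: "bump k s = s ^ j * bump (k + j) s"
  by (simp add: bump_def power_add)

text \<open>The series of \<open>exp (1 / s)\<close> dominates its single term of degree
  \<open>k + 2\<close>. The square serves twice: it makes \<open>bump k\<close> differentiable at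
  \<open>0\<close>, and it bounds \<open>bump k\<close> on arguments up to \<open>1\<close>.\<close>

lemma bump_le_square: "bump k s \<le> fact (k + 2) * s\<^sup>2"
proof (cases "s > 0")
  case True
  define F :: real where "F = fact (k + 2)"
  have F: "F > 0" by (simp add: F_def)
  have "(1 / s) ^ (k + 2) /\<^sub>R F \<le> (\<Sum>i<k + 3. (1 / s) ^ i /\<^sub>R fact i)"
    unfolding F_def by (rule member_le_sum) (use True in auto)
  also have "\<dots> \<le> exp (1 / s)"
    unfolding exp_def using True by (intro sum_le_suminf summable_exp_generic) auto
  finally have "inverse (F * s ^ (k + 2)) \<le> exp (1 / s)"
    by (simp only: power_inverse real_scaleR_def divide_inverse inverse_mult_distrib mult_1_left)
  then have "inverse (exp (1 / s)) \<le> F * s ^ (k + 2)"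
    using F True by (subst inverse_le_imp_le[of _ "inverse (exp (1 / s))"]) auto
  then have "exp (- 1 / s) \<le> fact (k + 2) * s ^ (k + 2)"
    by (simp add: F_def exp_minus del: fact_Suc)
  then have "exp (- 1 / s) / s ^ k \<le> fact (k + 2) * s ^ (k + 2) / s ^ k"
    using True by (intro divide_right_mono) auto
  then show ?thesis
    using True by (simp add: bump_def power_add power2_eq_square)
qed (simp add: bump_def)

lemma bump_has_derivative:
  "(bump k has_real_derivative (bump (k + 2) s - k * bump (k + 1) s)) (at s)"
proof -
  consider "s < 0" | "s = 0" | "s > 0" by linarith
  then show ?thesis
  proof cases
    case 1
    have "((\<lambda>_. 0) has_real_derivative 0) (at s)" by simp
    then have "(bump k has_real_derivative 0) (at s)"
      by (rule has_field_derivative_transform_within[where d = "-s"])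
         (use 1 in \<open>auto simp: bump_def dist_real_def\<close>)
    then show ?thesis using 1 by (simp add: bump_def)
  next
    case 2
    \<comment> \<open>All bumps vanish at \<open>0\<close>, so the claimed derivative is
      \<open>0\<close> there and the quadratic bound settles the difference quotient.\<close>
    have "((\<lambda>h. bump k h / h) \<longlongrightarrow> 0) (at 0)"
    proof (rule Lim_null_comparison)
      have "norm (bump k h / h) \<le> fact (k + 2) * \<bar>h\<bar>" if "h \<noteq> 0" for h
      proof -
        have "norm (bump k h / h) = bump k h / \<bar>h\<bar>"
          using bump_nonneg[of k h] by simp
        also have "\<dots> \<le> fact (k + 2) * h\<^sup>2 / \<bar>h\<bar>"
          by (intro divide_right_mono bump_le_square) simp
        also have "\<dots> = fact (k + 2) * \<bar>h\<bar>"
          using that by (simp add: power2_eq_square abs_if)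
        finally show ?thesis .
      qed
      then show "\<forall>\<^sub>F h in at 0. norm (bump k h / h) \<le> fact (k + 2) * \<bar>h\<bar>"
        by (auto simp: eventually_at_filter)
      show "((\<lambda>h::real. fact (k + 2) * \<bar>h\<bar>) \<longlongrightarrow> 0) (at 0)"
        by (rule tendsto_eq_intros refl | simp)+
    qed
    then show ?thesis
      unfolding 2 DERIV_def by (simp add: bump_def[of _ 0])
  next
    case 3
    have "((\<lambda>s. exp (- 1 / s) / s ^ k) has_real_derivative
        (bump (k + 2) s - k * bump (k + 1) s)) (at s)"
    proof (cases k)
      case 0
      then show ?thesis
        using 3 by (auto intro!: derivative_eq_intros simp: bump_def field_simps power2_eq_square)
    next
      case (Suc m)
      have "((\<lambda>s. exp (- 1 / s) * inverse (s ^ k)) has_real_derivative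
          exp (- 1 / s) * (1 / s\<^sup>2) * inverse (s ^ k) +
          (- (real k * s ^ m * inverse ((s ^ k)\<^sup>2))) * exp (- 1 / s)) (at s)"
      proof -
        have m: "k - Suc 0 = m" using Suc by simp
        show ?thesis
          using 3 by (auto intro!: derivative_eq_intros simp: m power2_eq_square divide_inverse)
      qed
      also have "exp (- 1 / s) * (1 / s\<^sup>2) * inverse (s ^ k) +
          (- (real k * s ^ m * inverse ((s ^ k)\<^sup>2))) * exp (- 1 / s)
        = bump (k + 2) s - k * bump (k + 1) s"
        using 3 by (simp add: bump_def Suc field_simps power2_eq_square)
      finally show ?thesis by (simp add: divide_inverse)
    qed
    then show ?thesis
      by (rule has_field_derivative_transform_within[where d = s])
         (use 3 in \<open>auto simp: bump_def dist_real_def\<close>)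
  qed
qed

lemma continuous_on_bump [continuous_intros]:
  "continuous_on S f \<Longrightarrow> continuous_on S (\<lambda>x. bump k (f x))"
  by (rule continuous_on_compose2[of UNIV "bump k"])
     (auto intro!: continuous_at_imp_continuous_on DERIV_isCont bump_has_derivative)

section \<open>Smooth radial functions supported in a ball\<close>

text \<open>A polynomial in \<open>x\<close> that for \<open>r > 0\<close> is positive exactly on
  the open ball of radius \<open>r\<close> about \<open>a\<close>. Composing it with
  \<open>bump k\<close> gives a smooth function supported in the closed ball.\<close>

definition quad :: "real^'n \<Rightarrow> real \<Rightarrow> real^'n::finite \<Rightarrow> real" where
  "quad a r x = 1 - (norm (x - a))\<^sup>2 / r\<^sup>2"

lemma quad_has_derivative:
  fixes a :: "real^'n::finite"
  shows
  "(quad a r has_derivative (\<lambda>h. - 2 * ((x - a) \<bullet> h) / r\<^sup>2)) (at x)"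
proof -
  have "((\<lambda>x. 1 - c * ((x - a) \<bullet> (x - a))) has_derivative (\<lambda>h. - 2 * ((x - a) \<bullet> h) * c)) (at x)" for c
    by (auto intro!: derivative_eq_intros simp: inner_commute)
  from this[of "1 / r\<^sup>2"] show ?thesis
    by (simp add: quad_def[abs_def] power2_norm_eq_inner)
qed

lemma partial_eq: "(f has_derivative f') (at x) \<Longrightarrow> partial i f x = f' (axis i 1)"
  using frechet_derivative_at by (metis partial_def)

lemma bump_quad_has_derivative:
  "((\<lambda>x. bump k (quad a r x)) has_derivative
     (\<lambda>h. (bump (k + 2) (quad a r x) - k * bump (k + 1) (quad a r x)) * (- 2 * ((x - a) \<bullet> h) / r\<^sup>2))) (at x)"
  using has_derivative_compose[OF quad_has_derivative bump_has_derivative[unfolded has_field_derivative_def]]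
  by simp

text \<open>An algebra of functions closed under partial derivatives, whence all its members are smooth.\<close>

inductive bump_algebra :: "(real^'n::finite \<Rightarrow> real) \<Rightarrow> bool" where
  const: "bump_algebra (\<lambda>x. c)"
| coord: "bump_algebra (\<lambda>x. x $ i)"
| bump: "bump_algebra (\<lambda>x. bump k (quad a r x))"
| add: "bump_algebra f \<Longrightarrow> bump_algebra g \<Longrightarrow> bump_algebra (\<lambda>x. f x + g x)"
| mult: "bump_algebra f \<Longrightarrow> bump_algebra g \<Longrightarrow> bump_algebra (\<lambda>x. f x * g x)"

lemma bump_algebra_partial:
  fixes f :: "real^'n::finite \<Rightarrow> real"
  assumes "bump_algebra f"
  shows "(\<forall>x. f differentiable (at x)) \<and> (\<forall>i. bump_algebra (partial i f))"
  using assms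
proof induction
  case (const c)
  have "partial i (\<lambda>x. c) = (\<lambda>x. 0)" for i :: 'n
    by (rule ext, rule partial_eq[THEN trans]) auto
  then show ?case using bump_algebra.const by auto
next
  case (coord j)
  have d: "((\<lambda>x. x $ j) has_derivative (\<lambda>h. h $ j)) (at x)" for x :: "real^'n"
    by (rule bounded_linear_imp_has_derivative) (rule bounded_linear_vec_nth)
  have "partial i (\<lambda>x. x $ j) = (\<lambda>x. if i = j then 1 else 0)" for i :: 'n
    by (rule ext, subst partial_eq[OF d]) (auto simp: axis_def)
  then show ?case using bump_algebra.const d by (auto simp: differentiable_def)
next
  case (bump k a r)
  \<comment> \<open>Differences are spelled as sums with negated constants, to match the
    introduction rules of the algebra.\<close>
  have "partial i (\<lambda>x. bump k (quad a r x)) = (\<lambda>x.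
      (bump (k + 2) (quad a r x) + (- k) * bump (k + 1) (quad a r x)) * ((- 2 / r\<^sup>2) * (x $ i + (- a $ i))))" for i
    by (rule ext, subst partial_eq[OF bump_quad_has_derivative])
       (simp add: inner_axis divide_inverse algebra_simps)
  moreover have "bump_algebra (\<lambda>x. (bump (k + 2) (quad a r x) + (- k) * bump (k + 1) (quad a r x))
      * ((- 2 / r\<^sup>2) * (x $ i + (- a $ i))))" for i
    by (intro bump_algebra.intros)
  moreover have "(\<lambda>x. bump k (quad a r x)) differentiable (at x)" for x
    unfolding differentiable_def using bump_quad_has_derivative by blast
  ultimately show ?case by simp
next
  case (add f g)
  have "partial i (\<lambda>x. f x + g x) = (\<lambda>x. partial i f x + partial i g x)" for i
    by (rule ext, rule partial_eq[THEN trans])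
       (use add in \<open>auto intro!: has_derivative_add frechet_derivative_works[THEN iffD1] simp: partial_def\<close>)
  then show ?case using add by (auto intro!: bump_algebra.add)
next
  case (mult f g)
  have "partial i (\<lambda>x. f x * g x) = (\<lambda>x. f x * partial i g x + partial i f x * g x)" for i
    by (rule ext, rule partial_eq[THEN trans])
       (use mult in \<open>auto intro!: has_derivative_mult frechet_derivative_works[THEN iffD1] simp: partial_def\<close>)
  then show ?case using mult by (auto intro!: bump_algebra.intros)
qed

lemma bump_algebra_smooth: "bump_algebra f \<Longrightarrow> smooth f"
  by (coinduction arbitrary: f) (use bump_algebra_partial in auto)

lemma quad_pos_iff: "r > 0 \<Longrightarrow> quad a r x > 0 \<longleftrightarrow> dist a x < r"
proof -
  assume r: "r > 0"
  have "quad a r x > 0 \<longleftrightarrow> (norm (x - a))\<^sup>2 < r\<^sup>2"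
    using r by (simp add: quad_def)
  also have "\<dots> \<longleftrightarrow> dist a x < r"
    using r power_mono_iff[of r "norm (x - a)" 2]
    by (simp add: not_le[symmetric] dist_norm norm_minus_commute)
  finally show ?thesis .
qed

lemma quad_le_1: "quad a r x \<le> 1"
  by (simp add: quad_def)

lemma continuous_on_quad [continuous_intros]: "continuous_on S (quad a r)"
  by (rule has_derivative_continuous_on[OF has_derivative_at_withinI[OF quad_has_derivative]])

section \<open>The mollifier, its kernel and the derivative in the scale\<close>

text \<open>The index \<open>2\<close> makes the profile the derivative of \<open>bump 0\<close>,
  which ties the mollifier to the gradient of \<open>bump_kernel\<close>. The power of
  \<open>r\<close> keeps the integral independent of the scale; there is no normalization to
  \<open>1\<close>.\<close>

definition mollifier :: "real^'n \<Rightarrow> real \<Rightarrow> real^'n::finite \<Rightarrow> real" where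
  "mollifier a r x = bump 2 (quad a r x) / r ^ CARD('n)"

text \<open>The function \<open>\<Phi>\<^sub>r\<close> of the overview: its gradient is
  \<open>- (x - a) / r\<close> times the mollifier.\<close>

definition bump_kernel :: "real^'n \<Rightarrow> real \<Rightarrow> real^'n::finite \<Rightarrow> real" where
  "bump_kernel a r x = r / (2 * r ^ CARD('n)) * bump 0 (quad a r x)"

definition mollifier_deriv :: "real^'n \<Rightarrow> real \<Rightarrow> real^'n::finite \<Rightarrow> real" where
  "mollifier_deriv a r x =
     ((bump 4 (quad a r x) - 2 * bump 3 (quad a r x)) * (2 * (norm (x - a))\<^sup>2 / r\<^sup>2)
       - CARD('n) * bump 2 (quad a r x)) / (r * r ^ CARD('n))"

lemma mollifier_has_derivative:
  fixes a x :: "real^'n::finite"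
  assumes "r > 0"
  shows "((\<lambda>r. mollifier a r x) has_real_derivative mollifier_deriv a r x) (at r)"
proof -
  have q: "((\<lambda>r. quad a r x) has_real_derivative 2 * (norm (x - a))\<^sup>2 / (r\<^sup>2 * r)) (at r)"
    unfolding quad_def using assms
    by (auto intro!: derivative_eq_intros simp: field_simps power2_eq_square)
  have Suc_simps: "Suc (Suc (Suc 0)) = 3" by simp
  obtain m where m: "CARD('n) = Suc m"
    using gr0_implies_Suc[OF zero_less_card_finite] by blast
  show ?thesis
    unfolding mollifier_def mollifier_deriv_def using assms
    by (rule_tac DERIV_cong[OF DERIV_divide[OF DERIV_chain2[OF bump_has_derivative q] DERIV_pow]])
       (auto simp: field_simps m power2_eq_square Suc_simps)
qed

lemma bump_kernel_test_function:
  fixes a :: "real^'n::finite"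
  assumes "r > 0"
  shows "test_function (bump_kernel a r)"
proof -
  have "smooth (bump_kernel a r)"
    unfolding bump_kernel_def[abs_def] by (intro bump_algebra_smooth bump_algebra.intros)
  moreover have "{x. bump_kernel a r x \<noteq> 0} \<subseteq> cball a r"
    using assms quad_pos_iff[of r a] by (auto simp: bump_kernel_def bump_def)
  then have "compact (closure {x. bump_kernel a r x \<noteq> 0})"
    by (meson bounded_cball bounded_subset compact_closure)
  ultimately show ?thesis by (simp add: test_function_def)
qed

text \<open>By the form of the gradient, the Laplacian is \<open>- 1 / r\<close> times the
  divergence of \<open>x - a\<close> times the mollifier. Scaling identifies this with the
  derivative of the mollifier in \<open>r\<close>; the proof compares the explicit formulas.\<close>

lemma laplacian_bump_kernel:
  fixes a :: "real^'n::finite"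
  assumes "r > 0"
  shows "laplacian (bump_kernel a r) = mollifier_deriv a r"
proof
  fix x :: "real^'n"
  define c where "c = 1 / (r * r ^ CARD('n))"
  have Suc_simps: "Suc (Suc 0) = 2" "Suc (Suc (Suc 0)) = 3" by simp_all
  have p: "partial i (bump_kernel a r) = (\<lambda>x. - c * ((x $ i - a $ i) * bump 2 (quad a r x)))" for i
    unfolding bump_kernel_def[abs_def]
    by (rule ext, subst partial_eq[OF has_derivative_mult_right[OF bump_quad_has_derivative]])
       (use assms in \<open>simp add: inner_axis c_def Suc_simps power2_eq_square field_simps\<close>)
  have "partial i (partial i (bump_kernel a r)) x = - c * (bump 2 (quad a r x)
       + (bump 4 (quad a r x) - 2 * bump 3 (quad a r x)) * (- 2 * ((x $ i - a $ i))\<^sup>2 / r\<^sup>2))" for i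
  proof -
    have d: "((\<lambda>x. x $ i - a $ i) has_derivative (\<lambda>h. h $ i)) (at x)"
      by (auto intro!: derivative_eq_intros bounded_linear_imp_has_derivative bounded_linear_vec_nth)
    show ?thesis
      unfolding p
      by (subst partial_eq[OF has_derivative_mult_right[OF has_derivative_mult[OF d bump_quad_has_derivative]]])
         (simp add: inner_axis Suc_simps divide_inverse power2_eq_square algebra_simps)
  qed
  then have "laplacian (bump_kernel a r) x = - c * (CARD('n) * bump 2 (quad a r x)
       + (bump 4 (quad a r x) - 2 * bump 3 (quad a r x)) * (- 2 * (\<Sum>i\<in>UNIV. (x $ i - a $ i)\<^sup>2) / r\<^sup>2))"
    by (simp add: laplacian_def sum.distrib sum_subtractf sum_negf right_diff_distrib
        sum_distrib_left sum_divide_distrib)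
  moreover have "(\<Sum>i\<in>UNIV. (x $ i - a $ i)\<^sup>2) = (norm (x - a))\<^sup>2"
    unfolding power2_norm_eq_inner inner_vec_def by (simp add: power2_eq_square)
  ultimately show "laplacian (bump_kernel a r) x = mollifier_deriv a r x"
    by (simp add: mollifier_deriv_def c_def) (simp add: divide_simps algebra_simps)
qed

lemma bump_kernel_nonneg: "r > 0 \<Longrightarrow> bump_kernel a r x \<ge> 0"
  by (simp add: bump_kernel_def bump_nonneg)

lemma bump_kernel_pos: "r > 0 \<Longrightarrow> dist a x < r \<Longrightarrow> bump_kernel a r x > 0"
  by (simp add: bump_kernel_def bump_pos quad_pos_iff)

lemma bump_kernel_eq_0: "r > 0 \<Longrightarrow> dist a x \<ge> r \<Longrightarrow> bump_kernel a r x = 0"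
  using quad_pos_iff[of r a x] by (simp add: bump_kernel_def bump_eq_0)

lemma mollifier_nonneg: "r > 0 \<Longrightarrow> mollifier a r x \<ge> 0"
  by (simp add: mollifier_def bump_nonneg)

lemma mollifier_pos: "r > 0 \<Longrightarrow> dist a x < r \<Longrightarrow> mollifier a r x > 0"
  by (simp add: mollifier_def bump_pos quad_pos_iff)

lemma mollifier_eq_0: "r > 0 \<Longrightarrow> dist a x \<ge> r \<Longrightarrow> mollifier a r x = 0"
  using quad_pos_iff[of r a x] by (simp add: mollifier_def bump_eq_0)

lemma mollifier_deriv_eq_0: "r > 0 \<Longrightarrow> dist a x \<ge> r \<Longrightarrow> mollifier_deriv a r x = 0"
  using quad_pos_iff[of r a x] by (simp add: mollifier_deriv_def bump_eq_0)

text \<open>On the ball \<open>quad\<close> lies between \<open>0\<close> and \<open>1\<close>, so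
  \<open>bump 0\<close> is \<open>bump 2\<close> times a factor of at most \<open>1\<close>. This is
  what bounds the derivative of a mean by the mean itself.\<close>

lemma bump_kernel_le_mollifier:
  assumes "r > 0"
  shows "bump_kernel a r x \<le> r / 2 * mollifier a r x"
proof -
  have "bump 0 (quad a r x) \<le> bump 2 (quad a r x)"
  proof (cases "quad a r x > 0")
    case True
    have "(quad a r x)\<^sup>2 * bump 2 (quad a r x) \<le> 1 * bump 2 (quad a r x)"
      using True quad_le_1[of a r x] by (intro mult_right_mono bump_nonneg) (simp add: power_le_one)
    then show ?thesis using bump_shift[of 0 "quad a r x" 2] by (simp add: numeral_2_eq_2)
  qed (simp add: bump_eq_0)
  then have "r / (2 * r ^ CARD('a)) * bump 0 (quad a r x) \<le> r / (2 * r ^ CARD('a)) * bump 2 (quad a r x)"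
    using assms by (intro mult_left_mono) auto
  then show ?thesis by (simp add: bump_kernel_def mollifier_def)
qed

text \<open>A substitute for the first Dirichlet eigenfunction of a ball: \<open>bump_kernel\<close>
  is a subsolution with eigenvalue of order \<open>1 / r\<^sup>2\<close>. Near the sphere the
  positive \<open>bump 4\<close> term wins; further inside, a large multiple of
  \<open>bump 0\<close> absorbs the negative terms.\<close>

lemma mollifier_deriv_ge_bump_kernel:
  "\<exists>C>0. \<forall>a r (x::real^'n::finite). r > 0 \<longrightarrow> mollifier_deriv a r x \<ge> - (C / r\<^sup>2) * bump_kernel a r x"
proof (intro exI conjI allI impI)
  define n where "n = real CARD('n)"
  \<comment> \<open>The two regimes are separated at \<open>s = 1 / (6 + n)\<close>; beyond it
    \<open>C * s ^ 4\<close> is at least \<open>6 + n\<close>, which absorbs \<open>6 * s\<close>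
    and \<open>n * s\<^sup>2\<close>.\<close>
  define C where "C = (6 + n) * (6 + n) ^ 4"
  have n: "n \<ge> 0" by (simp add: n_def)
  \<comment> \<open>The doubling compensates the factor \<open>1 / 2\<close> in
    \<open>bump_kernel\<close>.\<close>
  then show "2 * C > 0" by (simp add: C_def)
  fix a x :: "real^'n" and r :: real assume r: "r > 0"
  define s where "s = quad a r x"
  have x: "(norm (x - a))\<^sup>2 / r\<^sup>2 = 1 - s" by (simp add: s_def quad_def)
  have main: "(bump 4 s - 2 * bump 3 s) * (2 * (1 - s)) - n * bump 2 s + C * bump 0 s \<ge> 0"
  proof (cases "s > 0")
    case True
    have s1: "s \<le> 1" by (simp add: s_def quad_le_1)
    \<comment> \<open>The inequality after division by \<open>bump 4 s\<close>, now polynomial in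
      \<open>s\<close>.\<close>
    have "2 * (1 - s) * (1 - 2 * s) - n * s\<^sup>2 + C * s ^ 4 \<ge> 0"
    proof (cases "s \<le> 1 / (6 + n)")
      case True
      have "(6 + n) * s \<le> 1" using True n by (simp add: field_simps)
      moreover have "n * s\<^sup>2 \<le> n * s"
        using s1 \<open>s > 0\<close> n by (intro mult_left_mono) (auto simp: power2_eq_square mult_left_le)
      moreover have "2 * (1 - s) * (1 - 2 * s) = 2 - 6 * s + 4 * s\<^sup>2"
        by (simp add: power2_eq_square algebra_simps)
      moreover have "C * s ^ 4 \<ge> 0" using n by (simp add: C_def)
      moreover have "s\<^sup>2 \<ge> 0" by simp
      moreover have "(6 + n) * s = 6 * s + n * s" by (simp add: algebra_simps)
      ultimately show ?thesis by linarith
    next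
      case False
      then have "(6 + n) * s \<ge> 1" using n by (simp add: field_simps)
      then have "((6 + n) * s) ^ 4 \<ge> 1" by (rule one_le_power)
      then have "(6 + n) * ((6 + n) * s) ^ 4 \<ge> (6 + n) * 1" using n by (intro mult_left_mono) auto
      then have "C * s ^ 4 \<ge> 6 + n" by (simp add: C_def power_mult_distrib mult.assoc)
      moreover have "n * s\<^sup>2 \<le> n * 1"
        using s1 \<open>s > 0\<close> n by (intro mult_left_mono) (auto simp: power_le_one)
      moreover have "2 * (1 - s) * (1 - 2 * s) = 2 - 6 * s + 4 * s\<^sup>2"
        by (simp add: power2_eq_square algebra_simps)
      moreover have "s\<^sup>2 \<ge> 0" by simp
      ultimately show ?thesis using s1 by linarith
    qed
    then have "0 \<le> (2 * (1 - s) * (1 - 2 * s) - n * s\<^sup>2 + C * s ^ 4) * bump 4 s"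
      by (intro mult_nonneg_nonneg bump_nonneg)
    moreover have "bump 0 s = s ^ 4 * bump 4 s" "bump 2 s = s\<^sup>2 * bump 4 s" "bump 3 s = s * bump 4 s"
      using bump_shift[of 0 s 4] bump_shift[of 2 s 2] bump_shift[of 3 s 1] by simp_all
    ultimately show ?thesis by (simp add: algebra_simps)
  qed (simp add: bump_eq_0)
  then have "0 \<le> ((bump 4 s - 2 * bump 3 s) * (2 * (1 - s)) - n * bump 2 s + C * bump 0 s) / (r * r ^ CARD('n))"
    using r by auto
  also have "\<dots> = mollifier_deriv a r x + 2 * C / r\<^sup>2 * bump_kernel a r x"
    using r unfolding mollifier_deriv_def bump_kernel_def
    by (simp add: s_def[symmetric] n_def[symmetric] x flip: times_divide_eq_right)
       (simp add: field_simps power2_eq_square)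
  finally show "mollifier_deriv a r x \<ge> - (2 * C / r\<^sup>2) * bump_kernel a r x" by simp
qed

section \<open>Mollified means\<close>

text \<open>Dominated convergence along sequences: \<open>w\<close> bounds \<open>f' s\<close> for
  every \<open>s\<close> of the interval, hence also every difference quotient by the mean value
  inequality.\<close>

lemma has_real_derivative_integral:
  fixes f f' :: "real \<Rightarrow> 'a \<Rightarrow> real"
  assumes r: "r \<in> {c<..<d}"
    and int: "\<And>s. s \<in> {c<..<d} \<Longrightarrow> integrable M (f s)"
    and deriv: "\<And>s x. s \<in> {c<..<d} \<Longrightarrow> ((\<lambda>s. f s x) has_real_derivative f' s x) (at s)"
    and bound: "\<And>s x. s \<in> {c<..<d} \<Longrightarrow> \<bar>f' s x\<bar> \<le> w x"
    and w: "integrable M w" and meas: "f' r \<in> borel_measurable M"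
  shows "((\<lambda>s. integral\<^sup>L M (f s)) has_real_derivative integral\<^sup>L M (f' r)) (at r)"
  unfolding has_field_derivative_iff tendsto_at_iff_sequentially
proof (intro allI impI)
  fix X :: "nat \<Rightarrow> real"
  assume X: "\<forall>i. X i \<in> UNIV - {r}" "X \<longlonglongrightarrow> r"
  have "\<forall>\<^sub>F n in sequentially. X n \<in> {c<..<d}"
    by (rule topological_tendstoD[OF X(2)]) (use r in auto)
  then obtain N where N: "\<And>n. n \<ge> N \<Longrightarrow> X n \<in> {c<..<d}"
    by (auto simp: eventually_sequentially)
  \<comment> \<open>Dropping the first \<open>N\<close> terms puts the whole sequence inside the
    interval, so that the bounds hold for every index.\<close>
  define Y where "Y n = X (n + N)" for n
  have Y: "Y n \<in> {c<..<d}" "Y n \<noteq> r" for n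
    using N[of "n + N"] X(1) by (auto simp: Y_def)
  have Ylim: "Y \<longlonglongrightarrow> r"
    unfolding Y_def by (rule LIMSEQ_ignore_initial_segment[OF X(2)])
  have "(\<lambda>n. LINT x|M. (f (Y n) x - f r x) / (Y n - r)) \<longlonglongrightarrow> integral\<^sup>L M (f' r)"
  proof (rule integral_dominated_convergence[where w = w])
    show "(\<lambda>x. (f (Y n) x - f r x) / (Y n - r)) \<in> borel_measurable M" for n
      using int[OF Y(1)] int[OF r] by measurable
    show "AE x in M. (\<lambda>n. (f (Y n) x - f r x) / (Y n - r)) \<longlonglongrightarrow> f' r x"
    proof (rule AE_I2)
      fix x
      have "((\<lambda>s. (f s x - f r x) / (s - r)) \<longlongrightarrow> f' r x) (at r)"
        using deriv[OF r] unfolding has_field_derivative_iff .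
      then show "(\<lambda>n. (f (Y n) x - f r x) / (Y n - r)) \<longlonglongrightarrow> f' r x"
        unfolding tendsto_at_iff_sequentially comp_def using Y(2) Ylim by auto
    qed
    show "AE x in M. norm ((f (Y n) x - f r x) / (Y n - r)) \<le> w x" for n
    proof (rule AE_I2)
      fix x
      have "norm (f (Y n) x - f r x) \<le> w x * norm (Y n - r)"
        by (rule field_differentiable_bound[of "{c<..<d}" _ "\<lambda>s. f' s x"])
           (use Y r bound deriv in \<open>auto intro: has_field_derivative_at_within\<close>)
      then show "norm ((f (Y n) x - f r x) / (Y n - r)) \<le> w x"
        using Y(2)[of n] by (simp add: field_simps)
    qed
  qed (use w meas in auto)
  moreover have "(LINT x|M. (f (Y n) x - f r x) / (Y n - r))
      = (integral\<^sup>L M (f (Y n)) - integral\<^sup>L M (f r)) / (Y n - r)" for n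
    using int[OF Y(1)] int[OF r] by simp
  ultimately have "(\<lambda>n. (integral\<^sup>L M (f (Y n)) - integral\<^sup>L M (f r)) / (Y n - r)) \<longlonglongrightarrow> integral\<^sup>L M (f' r)"
    by (simp only:)
  then show "((\<lambda>s. (integral\<^sup>L M (f s) - integral\<^sup>L M (f r)) / (s - r)) \<circ> X) \<longlonglongrightarrow> integral\<^sup>L M (f' r)"
    by (rule_tac LIMSEQ_offset[where k = N]) (simp add: Y_def comp_def)
qed

section \<open>Integrability and uniform bounds\<close>

lemma integrable_mult_compact_support:
  fixes f \<phi> :: "'a::euclidean_space \<Rightarrow> real"
  assumes f: "set_integrable lborel (cball a R) f"
    and \<phi>: "\<phi> \<in> borel_measurable borel" "\<And>x. \<bar>\<phi> x\<bar> \<le> B" "\<And>x. dist a x \<ge> R \<Longrightarrow> \<phi> x = 0"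
  shows "integrable lborel (\<lambda>x. \<phi> x * f x)"
proof -
  let ?f = "\<lambda>x. indicat_real (cball a R) x *\<^sub>R f x"
  have f': "integrable lborel ?f" using f by (simp add: set_integrable_def)
  have "integrable lborel (\<lambda>x. \<phi> x * ?f x)"
  proof (rule Bochner_Integration.integrable_bound)
    show "integrable lborel (\<lambda>x. B * ?f x)" using f' by (rule integrable_mult_right)
    show "(\<lambda>x. \<phi> x * ?f x) \<in> borel_measurable lborel"
      using \<phi>(1) borel_measurable_integrable[OF f'] by (intro borel_measurable_times) auto
    have "\<bar>\<phi> x * ?f x\<bar> \<le> \<bar>B * ?f x\<bar>" for x
      using \<phi>(2)[of x] unfolding abs_mult by (intro mult_right_mono) auto
    then show "AE x in lborel. norm (\<phi> x * ?f x) \<le> norm (B * ?f x)" by simp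
  qed
  moreover have "\<phi> x * ?f x = \<phi> x * f x" for x
    using \<phi>(3)[of x] by (auto simp: indicator_def)
  ultimately show ?thesis by (simp only:)
qed

lemma bump_quad_le: "bump k (quad a r x) \<le> fact (k + 2)"
proof (cases "quad a r x > 0")
  case True
  have "fact (k + 2) * (quad a r x)\<^sup>2 \<le> fact (k + 2) * (1::real)"
    using True quad_le_1[of a r x] by (intro mult_left_mono) (auto simp: power_le_one)
  then show ?thesis using bump_le_square[of k "quad a r x"] by linarith
qed (simp add: bump_eq_0)

lemma borel_measurable_bump [measurable]: "bump k \<in> borel_measurable borel"
  by (rule borel_measurable_continuous_onI) (intro continuous_intros)

lemma borel_measurable_quad [measurable]:
  assumes [measurable]: "f \<in> borel_measurable M" "g \<in> borel_measurable M"
  shows "(\<lambda>x. quad (f x) r (g x)) \<in> borel_measurable M"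
  unfolding quad_def by measurable

lemma borel_measurable_mollifier [measurable]:
  assumes [measurable]: "f \<in> borel_measurable M" "g \<in> borel_measurable M"
  shows "(\<lambda>x. mollifier (f x) r (g x)) \<in> borel_measurable M"
  unfolding mollifier_def by measurable

lemma borel_measurable_bump_kernel [measurable]: "bump_kernel a r \<in> borel_measurable borel"
  unfolding bump_kernel_def[abs_def] by measurable

lemma borel_measurable_mollifier_deriv [measurable]: "mollifier_deriv a r \<in> borel_measurable borel"
  unfolding mollifier_deriv_def[abs_def] by measurable

lemma mollifier_bound:
  fixes a :: "real^'n::finite"
  assumes "r > 0"
  shows "\<bar>mollifier a r x\<bar> \<le> fact 4 / r ^ CARD('n)"
  using assms bump_quad_le[of 2 a r x] bump_nonneg[of 2 "quad a r x"]
  by (simp add: mollifier_def divide_right_mono)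

lemma bump_kernel_bound:
  fixes a :: "real^'n::finite"
  assumes "r > 0"
  shows "\<bar>bump_kernel a r x\<bar> \<le> r / 2 * (fact 4 / r ^ CARD('n))"
proof -
  have "r / 2 * mollifier a r x \<le> r / 2 * (fact 4 / r ^ CARD('n))"
    using assms mollifier_bound[OF assms, of a x] by (intro mult_left_mono) auto
  then show ?thesis
    using bump_kernel_le_mollifier[OF assms, of a x] bump_kernel_nonneg[OF assms, of a x] by linarith
qed

text \<open>The constant does not depend on the centre, the point or the scale, so the bound
  dominates uniformly while \<open>r\<close> stays away from \<open>0\<close>.\<close>

lemma mollifier_deriv_bound:
  "\<exists>C\<ge>0. \<forall>a (x::real^'n::finite) r. r > 0 \<longrightarrow> \<bar>mollifier_deriv a r x\<bar> \<le> C / (r * r ^ CARD('n))"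
proof (intro exI conjI allI impI)
  \<comment> \<open>The factorials are the bounds of \<open>bump_quad_le\<close> for
    \<open>bump 4\<close>, \<open>bump 3\<close> and \<open>bump 2\<close>; the outer factor
    \<open>2\<close> bounds \<open>2 * (1 - s)\<close>.\<close>
  define C :: real where "C = (fact 6 + 2 * fact 5) * 2 + real CARD('n) * fact 4"
  show "C \<ge> 0" by (simp add: C_def)
  fix a x :: "real^'n" and r :: real assume r: "r > 0"
  show "\<bar>mollifier_deriv a r x\<bar> \<le> C / (r * r ^ CARD('n))"
  proof (cases "dist a x < r")
    case True
    define s where "s = quad a r x"
    have s: "0 < s" "s \<le> 1" using True r by (auto simp: s_def quad_pos_iff quad_le_1)
    have x: "2 * (norm (x - a))\<^sup>2 / r\<^sup>2 = 2 * (1 - s)" by (simp add: s_def quad_def)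
    have b: "\<bar>bump 2 s\<bar> \<le> fact 4" "\<bar>bump 3 s\<bar> \<le> fact 5" "\<bar>bump 4 s\<bar> \<le> fact 6"
      using bump_quad_le[of 2 a r x] bump_quad_le[of 3 a r x] bump_quad_le[of 4 a r x]
        bump_nonneg[of 2 s] bump_nonneg[of 3 s] bump_nonneg[of 4 s] by (simp_all add: s_def)
    have "\<bar>(bump 4 s - 2 * bump 3 s) * (2 * (1 - s))\<bar> \<le> (fact 6 + 2 * fact 5) * 2"
      unfolding abs_mult using b s by (intro mult_mono) (auto simp del: fact_numeral)
    moreover have "\<bar>real CARD('n) * bump 2 s\<bar> \<le> real CARD('n) * fact 4"
      using mult_left_mono[OF b(1), of "real CARD('n)"] by (simp add: abs_mult del: fact_numeral)
    ultimately have "\<bar>(bump 4 s - 2 * bump 3 s) * (2 * (1 - s)) - CARD('n) * bump 2 s\<bar> \<le> C"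
      unfolding C_def by linarith
    then have "\<bar>(bump 4 s - 2 * bump 3 s) * (2 * (1 - s)) - CARD('n) * bump 2 s\<bar> / (r * r ^ CARD('n))
        \<le> C / (r * r ^ CARD('n))"
      using r by (intro divide_right_mono) auto
    then show ?thesis
      using r by (simp add: mollifier_deriv_def s_def[symmetric] x abs_mult)
  next
    case False
    then show ?thesis using r \<open>C \<ge> 0\<close> mollifier_deriv_eq_0[of r a x] by simp
  qed
qed

section \<open>Total mass of the mollifier\<close>

text \<open>The type argument carries the dimension. Every centre and every positive scale give the
  same value, as shown below.\<close>

definition mollifier_mass :: "'n::finite itself \<Rightarrow> real" where
  "mollifier_mass _ = (LINT x|lborel. mollifier (0::real^'n) 1 x)"

lemma set_integrable_const_cball: "set_integrable lborel (cball (a::'a::euclidean_space) R) (\<lambda>_. c::real)"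
  unfolding set_integrable_def by (rule borel_integrable_compact) auto

lemma integrable_mollifier:
  fixes a :: "real^'n::finite"
  assumes "r > 0"
  shows "integrable lborel (mollifier a r)"
  using integrable_mult_compact_support[OF set_integrable_const_cball[of a r 1], of "mollifier a r" "fact 4 / r ^ CARD('n)"]
    mollifier_bound[OF assms, of a] mollifier_eq_0[OF assms, of a] by simp

lemma mollifier_symmetric: "mollifier a r x = mollifier x r a"
  by (simp add: mollifier_def quad_def norm_minus_commute)

text \<open>The substitution of \<open>a + r *\<^sub>R x\<close> for \<open>x\<close> leads to the
  reference mollifier, its Jacobian cancelling the power of \<open>r\<close> in the definition. This
  extended nonnegative form is the one used with Tonelli.\<close>

lemma nn_integral_mollifier:
  fixes a :: "real^'n::finite"
  assumes "r > 0"
  shows "(\<integral>\<^sup>+x. mollifier a r x \<partial>lborel) = mollifier_mass TYPE('n)"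
proof -
  have "(\<integral>\<^sup>+x. mollifier a r x \<partial>lborel)
      = (\<integral>\<^sup>+x. mollifier a r x \<partial>Nonnegative_Lebesgue_Integration.density (distr lborel borel (\<lambda>x. a + r *\<^sub>R x)) (\<lambda>_. \<bar>r\<bar> ^ DIM(real^'n)))"
    using assms by (subst lborel_affine[of r a, symmetric]) auto
  also have "\<dots> = (\<integral>\<^sup>+x. ennreal (r ^ CARD('n)) * mollifier a r (a + r *\<^sub>R x) \<partial>lborel)"
    using assms by (subst nn_integral_density) (auto simp: nn_integral_distr)
  also have "\<dots> = (\<integral>\<^sup>+x. mollifier (0::real^'n) 1 x \<partial>lborel)"
  proof (rule nn_integral_cong)
    fix x :: "real^'n"
    have "r ^ CARD('n) * mollifier a r (a + r *\<^sub>R x) = mollifier 0 1 x"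
      using assms by (simp add: mollifier_def quad_def power_mult_distrib)
    then show "ennreal (r ^ CARD('n)) * mollifier a r (a + r *\<^sub>R x) = mollifier (0::real^'n) 1 x"
      using assms by (simp flip: ennreal_mult' add: mollifier_nonneg)
  qed
  also have "\<dots> = mollifier_mass TYPE('n)"
    unfolding mollifier_mass_def
    by (rule nn_integral_eq_integral[OF integrable_mollifier]) (auto simp: mollifier_nonneg)
  finally show ?thesis .
qed

lemma integral_mollifier:
  fixes a :: "real^'n::finite"
  assumes "r > 0"
  shows "(LINT x|lborel. mollifier a r x) = mollifier_mass TYPE('n)"
proof -
  have "mollifier_mass TYPE('n) \<ge> 0"
    unfolding mollifier_mass_def by (rule integral_nonneg_AE) (simp add: mollifier_nonneg)
  then show ?thesis
    using nn_integral_mollifier[OF assms, of a]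
      nn_integral_eq_integral[OF integrable_mollifier[OF assms, of a]] assms
    by (simp add: mollifier_nonneg integral_nonneg_AE)
qed

text \<open>The product \<open>\<phi> x * v x\<close> is nonnegative with integral at most
  \<open>0\<close>, hence zero almost everywhere, and \<open>\<phi>\<close> can be cancelled on the
  ball. Vanishing means are turned into vanishing functions this way.\<close>

lemma AE_ball_zero_of_integral:
  fixes v \<phi> :: "real^'n::finite \<Rightarrow> real"
  assumes "integrable lborel (\<lambda>x. \<phi> x * v x)" "(LINT x|lborel. \<phi> x * v x) \<le> 0"
    and "\<And>x. \<phi> x \<ge> 0" "\<And>x. v x \<ge> 0" "\<And>x. dist a x < r \<Longrightarrow> \<phi> x > 0"
  shows "AE x in lborel. dist a x < r \<longrightarrow> v x = 0"
proof -
  have nonneg: "AE x in lborel. 0 \<le> \<phi> x * v x" using assms by simp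
  have "AE x in lborel. \<phi> x * v x = 0"
    using integral_nonneg_eq_0_iff_AE[OF assms(1) nonneg] integral_nonneg_AE[OF nonneg] assms(2)
    by linarith
  then show ?thesis
    by (rule AE_mp) (use assms(5) in fastforce)
qed

text \<open>Otherwise the preceding lemma, with the constant \<open>1\<close> for \<open>v\<close>,
  would make the unit ball a null set.\<close>

lemma mollifier_mass_pos: "mollifier_mass TYPE('n::finite) > 0"
proof (rule ccontr)
  assume "\<not> ?thesis"
  then have "AE x in lborel. dist (0::real^'n) x < 1 \<longrightarrow> (1::real) = 0"
    by (intro AE_ball_zero_of_integral[of "mollifier 0 1"])
       (auto simp: mollifier_mass_def integrable_mollifier mollifier_nonneg mollifier_pos)
  then have "emeasure lborel (ball (0::real^'n) 1) = 0"
    by (subst (asm) AE_iff_measurable[OF _ refl]) (auto simp: ball_def)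
  then show False
    using content_ball_pos[of 1 "0::real^'n"] by (simp add: measure_def)
qed

section \<open>Convergence of the means to the function\<close>

text \<open>Boxes are an intersection-stable generator of the Borel sets. With finiteness along an
  exhausting sequence of boxes the two measures with densities \<open>f\<close> and \<open>g\<close>
  coincide, and densities are unique almost everywhere.\<close>

lemma AE_eqI_box:
  fixes f g :: "'a::euclidean_space \<Rightarrow> ennreal"
  assumes [measurable]: "f \<in> borel_measurable borel" "g \<in> borel_measurable borel"
    and eq: "\<And>l u. (\<integral>\<^sup>+x. f x * indicator (box l u) x \<partial>lborel) = (\<integral>\<^sup>+x. g x * indicator (box l u) x \<partial>lborel)"
    and fin: "\<And>l u. (\<integral>\<^sup>+x. f x * indicator (box l u) x \<partial>lborel) \<noteq> \<infinity>"
  shows "AE x in lborel. f x = g x"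
proof (rule sigma_finite_measure.density_unique[OF sigma_finite_lborel])
  let ?M = "\<lambda>f. Nonnegative_Lebesgue_Integration.density lborel f"
  show "?M f = ?M g"
  proof (rule measure_eqI_generator_eq)
    let ?E = "range (\<lambda>(l, u). box l u :: 'a set)"
    let ?A = "\<lambda>n::nat. box (- (real n *\<^sub>R One)) (real n *\<^sub>R One) :: 'a set"
    show "Int_stable ?E" by (auto simp: Int_stable_def box_Int_box)
    show "?E \<subseteq> Pow UNIV" "sets (?M f) = sigma_sets UNIV ?E" "sets (?M g) = sigma_sets UNIV ?E"
      by (simp_all add: borel_eq_box)
    show "range ?A \<subseteq> ?E" "(\<Union>i. ?A i) = UNIV"
      unfolding UN_box_eq_UNIV by auto
    show "emeasure (?M f) (?A i) \<noteq> \<infinity>" for i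
      using fin by (simp add: emeasure_density)
    show "emeasure (?M f) X = emeasure (?M g) X" if "X \<in> ?E" for X
      using that eq by (auto simp: emeasure_density)
  qed
qed auto

text \<open>By Tonelli, the integral of the means over a box is that of \<open>v\<close> against a mollified indicator.\<close>

lemma mollified_limit_AE_eq:
  fixes v w :: "real^'n::finite \<Rightarrow> real" and R :: "nat \<Rightarrow> real"
  defines "m \<equiv> \<lambda>n a. LINT x|lborel. mollifier a (R n) x * v x"
  assumes v: "\<And>x. v x \<ge> 0" "v \<in> borel_measurable borel" "\<And>K. compact K \<Longrightarrow> set_integrable lborel K v"
    and R: "\<And>n. 0 < R n" "\<And>n. R n \<le> 1" "R \<longlonglongrightarrow> 0"
    and lim: "\<And>a. (\<lambda>n. m n a) \<longlonglongrightarrow> w a" and bound: "\<And>n a. m n a \<le> B"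
  shows "AE x in lborel. w x = mollifier_mass TYPE('n) * v x"
proof -
  note [measurable] = v(2)
  define c where "c = mollifier_mass TYPE('n)"
  have c: "c > 0" by (simp add: c_def mollifier_mass_pos)
  have int: "integrable lborel (\<lambda>x. mollifier a (R n) x * v x)" for n a
    by (rule integrable_mult_compact_support[OF v(3)[OF compact_cball] _ mollifier_bound[OF R(1)] mollifier_eq_0[OF R(1)]])
       (use borel_measurable_mollifier[OF borel_measurable_const measurable_ident] in simp)+
  have m_nn: "ennreal (m n a) = (\<integral>\<^sup>+x. mollifier a (R n) x * v x \<partial>lborel)" for n a
    unfolding m_def using int v(1) R(1)
    by (intro nn_integral_eq_integral[symmetric]) (auto simp: mollifier_nonneg)
  have m0: "m n a \<ge> 0" for n a
    unfolding m_def using v(1) R(1) by (intro integral_nonneg_AE) (auto simp: mollifier_nonneg)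
  have w0: "w a \<ge> 0" for a by (rule LIMSEQ_le_const[OF lim]) (use m0 in auto)
  have wB: "w a \<le> B" for a by (rule LIMSEQ_le_const2[OF lim]) (use bound in auto)
  have m_meas [measurable]: "m n \<in> borel_measurable borel" for n
    unfolding m_def by measurable
  have w_meas [measurable]: "w \<in> borel_measurable borel"
    by (rule borel_measurable_LIMSEQ_real[OF lim]) measurable
  \<comment> \<open>Both sides are limits of the same sequence, the box integrals of the means: the
    left one by dominated convergence, the right one after exchanging the integrals.\<close>
  have box_eq: "(\<integral>\<^sup>+a. ennreal (w a) * indicator (box l u) a \<partial>lborel)
      = (\<integral>\<^sup>+x. ennreal (c * v x) * indicator (box l u) x \<partial>lborel)" for l u :: "real^'n"
  proof (rule LIMSEQ_unique)
    let ?A = "box l u"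
    have A_fin: "emeasure lborel ?A < \<infinity>" by (rule emeasure_bounded_finite[OF bounded_box])
    show "(\<lambda>n. \<integral>\<^sup>+a. ennreal (m n a) * indicator ?A a \<partial>lborel)
        \<longlonglongrightarrow> (\<integral>\<^sup>+a. ennreal (w a) * indicator ?A a \<partial>lborel)"
    proof (rule nn_integral_dominated_convergence[where w = "\<lambda>a. ennreal B * indicator ?A a"])
      show "AE a in lborel. ennreal (m n a) * indicator ?A a \<le> ennreal B * indicator ?A a" for n
        using bound by (intro AE_I2 mult_right_mono ennreal_leI) auto
      show "(\<integral>\<^sup>+a. ennreal B * indicator ?A a \<partial>lborel) < \<infinity>"
        using A_fin by (simp add: nn_integral_cmult_indicator ennreal_mult_less_top)
      show "AE a in lborel. (\<lambda>n. ennreal (m n a) * indicator ?A a) \<longlonglongrightarrow> ennreal (w a) * indicator ?A a"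
        using lim by (intro AE_I2) (auto simp: indicator_def intro!: tendsto_ennrealI)
    qed measurable
    \<comment> \<open>The mollified indicator: \<open>c\<close> where the ball of radius
      \<open>R n\<close> lies in the box, \<open>0\<close> where it misses the box.\<close>
    define J where "J n x = (\<integral>\<^sup>+a. ennreal (mollifier x (R n) a) * indicator ?A a \<partial>lborel)" for n x
    have J_meas [measurable]: "J n \<in> borel_measurable borel" for n
      unfolding J_def by measurable
    have J_le: "J n x \<le> c" for n x
    proof -
      have "J n x \<le> (\<integral>\<^sup>+a. ennreal (mollifier x (R n) a) \<partial>lborel)"
        unfolding J_def by (intro nn_integral_mono) (auto simp: indicator_def)
      then show ?thesis using nn_integral_mollifier[OF R(1)[of n], of x] by (simp add: c_def)
    qed
    have J_in: "J n x = c" if "ball x (R n) \<subseteq> ?A" for n x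
    proof -
      have "J n x = (\<integral>\<^sup>+a. ennreal (mollifier x (R n) a) \<partial>lborel)"
        unfolding J_def using that mollifier_eq_0[OF R(1)[of n], of x]
        by (intro nn_integral_cong) (fastforce simp: indicator_def subset_iff not_less)
      then show ?thesis using nn_integral_mollifier[OF R(1)[of n], of x] by (simp add: c_def)
    qed
    have J_out: "J n x = 0" if "ball x (R n) \<inter> ?A = {}" for n x
    proof -
      have "J n x = (\<integral>\<^sup>+a. 0 \<partial>(lborel :: (real^'n) measure))"
        unfolding J_def using that mollifier_eq_0[OF R(1)[of n], of x]
        by (intro nn_integral_cong) (simp add: disjoint_iff indicator_def, metis ennreal_0 not_le)
      then show ?thesis by simp
    qed
    have ball_sub: "\<forall>\<^sub>F n in sequentially. ball x (R n) \<subseteq> S" if S: "open S" "x \<in> S" for x :: "real^'n" and S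
    proof -
      obtain e where e: "e > 0" "ball x e \<subseteq> S" using openE[OF S] .
      have "\<forall>\<^sub>F n in sequentially. R n < e" by (rule order_tendstoD(2)[OF R(3) e(1)])
      then show ?thesis by eventually_elim (use e in auto)
    qed
    \<comment> \<open>Pointwise convergence can fail only on the frontier of the box, a null
      set.\<close>
    have J_lim: "AE x in lborel. (\<lambda>n. J n x) \<longlonglongrightarrow> c * indicator ?A x"
    proof -
      have "AE x in lborel. x \<notin> cbox l u - box l u"
        using negligible_frontier_interval[of l u]
        by (intro AE_not_in) (auto simp: negligible_iff_null_sets null_sets_completion_iff)
      then show ?thesis
      proof (rule AE_mp, intro AE_I2 impI)
        fix x assume x: "x \<notin> cbox l u - box l u"
        have "\<forall>\<^sub>F n in sequentially. J n x = c * indicator ?A x"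
        proof (cases "x \<in> ?A")
          case True
          show ?thesis
            using ball_sub[OF open_box True] by eventually_elim (use True in \<open>simp add: J_in\<close>)
        next
          case False
          with x have "x \<in> - cbox l u" by auto
          from ball_sub[OF _ this] have "\<forall>\<^sub>F n in sequentially. ball x (R n) \<subseteq> - cbox l u"
            by (simp add: closed_cbox open_Compl)
          then show ?thesis
          proof eventually_elim
            case (elim n)
            then have "ball x (R n) \<inter> ?A = {}" using box_subset_cbox[of l u] by auto
            then show ?case using False by (simp add: J_out)
          qed
        qed
        then show "(\<lambda>n. J n x) \<longlonglongrightarrow> c * indicator ?A x" by (rule tendsto_eventually)
      qed
    qed
    have swap: "(\<integral>\<^sup>+a. ennreal (m n a) * indicator ?A a \<partial>lborel) = (\<integral>\<^sup>+x. ennreal (v x) * J n x \<partial>lborel)" for n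
    proof -
      have "(\<integral>\<^sup>+a. ennreal (m n a) * indicator ?A a \<partial>lborel)
          = (\<integral>\<^sup>+a. \<integral>\<^sup>+x. ennreal (v x) * (ennreal (mollifier x (R n) a) * indicator ?A a) \<partial>lborel \<partial>lborel)"
        unfolding m_nn
        by (subst nn_integral_multc[symmetric])
           (auto intro!: nn_integral_cong simp: ennreal_mult' v(1) mollifier_symmetric mult_ac)
      also have "\<dots> = (\<integral>\<^sup>+x. \<integral>\<^sup>+a. ennreal (v x) * (ennreal (mollifier x (R n) a) * indicator ?A a) \<partial>lborel \<partial>lborel)"
        by (rule lborel_pair.Fubini') measurable
      also have "\<dots> = (\<integral>\<^sup>+x. ennreal (v x) * J n x \<partial>lborel)"
        unfolding J_def by (intro nn_integral_cong nn_integral_cmult) measurable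
      finally show ?thesis .
    qed
    \<comment> \<open>Since \<open>R n \<le> 1\<close>, a ball of radius \<open>r0 + 1\<close>
      contains the supports of all \<open>J n\<close>; local integrability of \<open>v\<close> there
      yields the dominating function.\<close>
    obtain r0 where r0: "?A \<subseteq> ball 0 r0"
      using bounded_box bounded_subset_ballD by blast
    let ?K = "cball (0::real^'n) (r0 + 1)"
    have [measurable]: "?K \<in> sets borel" by simp
    have J_K: "J n x = J n x * indicator ?K x" for n x
    proof (cases "x \<in> ?K")
      case False
      have "ball x (R n) \<inter> ?A = {}"
      proof (rule ccontr)
        assume "ball x (R n) \<inter> ?A \<noteq> {}"
        then obtain y where "dist x y < R n" "y \<in> ?A" by auto
        then have "dist x y < R n" "y \<in> ball 0 r0" using r0 by auto
        then have "norm x \<le> r0 + 1"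
          using norm_triangle_ineq2[of x y] R(2)[of n] by (simp add: dist_norm)
        then show False using False by simp
      qed
      then show ?thesis by (simp add: J_out)
    qed simp
    have "(\<lambda>n. \<integral>\<^sup>+x. ennreal (v x) * J n x \<partial>lborel) \<longlonglongrightarrow> (\<integral>\<^sup>+x. ennreal (v x) * (c * indicator ?A x) \<partial>lborel)"
    proof (rule nn_integral_dominated_convergence[where w = "\<lambda>x. ennreal c * ennreal (indicator ?K x *\<^sub>R v x)"])
      show "AE x in lborel. ennreal (v x) * J n x \<le> ennreal c * ennreal (indicator ?K x *\<^sub>R v x)" for n
      proof (rule AE_I2)
        fix x
        have "ennreal (v x) * J n x = ennreal (v x) * indicator ?K x * J n x"
          by (subst J_K) (simp add: mult_ac)
        also have "\<dots> \<le> ennreal (v x) * indicator ?K x * c"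
          by (intro mult_left_mono J_le) simp
        finally show "ennreal (v x) * J n x \<le> ennreal c * ennreal (indicator ?K x *\<^sub>R v x)"
          by (auto simp: indicator_def mult_ac)
      qed
      have "(\<integral>\<^sup>+x. ennreal (indicator ?K x *\<^sub>R v x) \<partial>lborel) < \<infinity>"
        using v(3)[OF compact_cball, of 0 "r0 + 1"] v(1)
        unfolding set_integrable_def real_integrable_def
        by (simp add: less_top[symmetric])
      then show "(\<integral>\<^sup>+x. ennreal c * ennreal (indicator ?K x *\<^sub>R v x) \<partial>lborel) < \<infinity>"
        by (subst nn_integral_cmult) (measurable, simp add: ennreal_mult_less_top)
      show "AE x in lborel. (\<lambda>n. ennreal (v x) * J n x) \<longlonglongrightarrow> ennreal (v x) * (c * indicator ?A x)"
        using J_lim by (rule AE_mp) (auto intro!: AE_I2 ennreal_tendsto_cmult)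
    qed measurable
    also have "(\<integral>\<^sup>+x. ennreal (v x) * (c * indicator ?A x) \<partial>lborel)
        = (\<integral>\<^sup>+x. ennreal (c * v x) * indicator ?A x \<partial>lborel)"
      using c v(1) by (intro nn_integral_cong) (auto simp: ennreal_mult' indicator_def mult_ac)
    finally show "(\<lambda>n. \<integral>\<^sup>+a. ennreal (m n a) * indicator ?A a \<partial>lborel)
        \<longlonglongrightarrow> (\<integral>\<^sup>+x. ennreal (c * v x) * indicator ?A x \<partial>lborel)"
      unfolding swap .
  qed
  have "(\<integral>\<^sup>+a. ennreal (w a) * indicator (box l u) a \<partial>lborel) \<noteq> \<infinity>" for l u :: "real^'n"
  proof -
    have "(\<integral>\<^sup>+a. ennreal (w a) * indicator (box l u) a \<partial>lborel)
        \<le> (\<integral>\<^sup>+a. ennreal B * indicator (box l u) a \<partial>lborel)"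
      using wB by (intro nn_integral_mono mult_right_mono ennreal_leI) auto
    also have "\<dots> < \<infinity>"
      using emeasure_bounded_finite[OF bounded_box, of l u]
      by (simp add: nn_integral_cmult_indicator ennreal_mult_less_top)
    finally show ?thesis by simp
  qed
  then have "AE x in lborel. ennreal (w x) = ennreal (c * v x)"
    by (intro AE_eqI_box box_eq) measurable
  then show ?thesis
    by (rule AE_mp) (use w0 v(1) c in \<open>auto simp: c_def\<close>)
qed

section \<open>Nonnegative distributional solutions of \<open>\<Delta> v = g\<close>\<close>

locale poisson_equation =
  fixes v g :: "real^'n::finite \<Rightarrow> real"
  assumes v_nonneg: "\<And>x. v x \<ge> 0"
    and v_measurable [measurable]: "v \<in> borel_measurable borel"
    and v_locally_integrable: "\<And>K. compact K \<Longrightarrow> set_integrable lborel K v"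
    and g_locally_integrable: "\<And>K. compact K \<Longrightarrow> set_integrable lborel K g"
    and poisson: "\<And>\<phi>. test_function \<phi> \<Longrightarrow>
      (LINT x|lborel. laplacian \<phi> x * v x) = (LINT x|lborel. \<phi> x * g x)"
begin

definition mean :: "real \<Rightarrow> real^'n \<Rightarrow> real" where
  "mean r a = (LINT x|lborel. mollifier a r x * v x)"

lemma integrable_mollifier_mult:
  fixes f :: "real^'n \<Rightarrow> real"
  assumes "r > 0" "\<And>K. compact K \<Longrightarrow> set_integrable lborel K f"
  shows "integrable lborel (\<lambda>x. mollifier a r x * f x)"
  by (rule integrable_mult_compact_support[OF assms(2)[OF compact_cball] _ mollifier_bound[OF assms(1)] mollifier_eq_0[OF assms(1)]])
     (use borel_measurable_mollifier[OF borel_measurable_const measurable_ident] in simp)+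

lemma integrable_bump_kernel_mult:
  fixes f :: "real^'n \<Rightarrow> real"
  assumes "r > 0" "\<And>K. compact K \<Longrightarrow> set_integrable lborel K f"
  shows "integrable lborel (\<lambda>x. bump_kernel a r x * f x)"
  by (rule integrable_mult_compact_support[OF assms(2)[OF compact_cball] _ bump_kernel_bound[OF assms(1)] bump_kernel_eq_0[OF assms(1)]])
     (use borel_measurable_bump_kernel in simp)+

lemma integrable_mollifier_deriv_mult:
  assumes "r > 0"
  shows "integrable lborel (\<lambda>x. mollifier_deriv a r x * v x)"
proof -
  obtain C where C: "C \<ge> 0" "\<And>a x r. r > 0 \<Longrightarrow> \<bar>mollifier_deriv a r (x::real^'n)\<bar> \<le> C / (r * r ^ CARD('n))"
    using mollifier_deriv_bound[where 'n = 'n] by blast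
  show ?thesis
    by (rule integrable_mult_compact_support[OF v_locally_integrable[OF compact_cball] borel_measurable_mollifier_deriv C(2)[OF assms] mollifier_deriv_eq_0[OF assms]])
qed

text \<open>The one use of the differential equation, with \<open>bump_kernel a r\<close> as test
  function.\<close>

lemma integral_mollifier_deriv:
  assumes "r > 0"
  shows "(LINT x|lborel. mollifier_deriv a r x * v x) = (LINT x|lborel. bump_kernel a r x * g x)"
  using poisson[OF bump_kernel_test_function[OF assms, of a]] by (simp add: laplacian_bump_kernel[OF assms])

lemma mean_nonneg: "r > 0 \<Longrightarrow> mean r a \<ge> 0"
  unfolding mean_def by (intro integral_nonneg_AE) (auto simp: mollifier_nonneg v_nonneg)

lemma mean_has_derivative:
  assumes r: "r > 0"
  shows "((\<lambda>r. mean r a) has_real_derivative (LINT x|lborel. bump_kernel a r x * g x)) (at r)"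
  unfolding mean_def integral_mollifier_deriv[OF r, symmetric]
proof -
  obtain C where C: "C \<ge> 0" "\<And>a x r. r > 0 \<Longrightarrow> \<bar>mollifier_deriv a r (x::real^'n)\<bar> \<le> C / (r * r ^ CARD('n))"
    using mollifier_deriv_bound[where 'n = 'n] by blast
  \<comment> \<open>The derivative bound at the smallest scale considered, \<open>r / 2\<close>;
    scales up to \<open>2 * r\<close> keep the supports in a fixed ball.\<close>
  define B where "B = C / (r / 2 * (r / 2) ^ CARD('n))"
  show "((\<lambda>r. LINT x|lborel. mollifier a r x * v x) has_real_derivative
      (LINT x|lborel. mollifier_deriv a r x * v x)) (at r)"
  proof (rule has_real_derivative_integral[where c = "r / 2" and d = "2 * r"
        and w = "\<lambda>x. B * (indicator (cball a (2 * r)) x *\<^sub>R v x)"])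
    fix s x assume "s \<in> {r / 2<..<2 * r}"
    then have s: "s > 0" "r / 2 \<le> s" "s < 2 * r" using r by auto
    show "integrable lborel (\<lambda>x. mollifier a s x * v x)"
      by (rule integrable_mollifier_mult[OF s(1) v_locally_integrable])
    show "((\<lambda>s. mollifier a s x * v x) has_real_derivative mollifier_deriv a s x * v x) (at s)"
      by (intro DERIV_cmult_right mollifier_has_derivative s)
    have "r / 2 * (r / 2) ^ CARD('n) \<le> s * s ^ CARD('n)"
      using s r by (intro mult_mono power_mono) auto
    then have "C / (s * s ^ CARD('n)) \<le> B"
      unfolding B_def using C(1) r s by (intro divide_left_mono) auto
    then have "\<bar>mollifier_deriv a s x\<bar> \<le> B"
      using C(2)[OF s(1), of a x] by linarith
    then have "\<bar>mollifier_deriv a s x\<bar> * v x \<le> B * v x"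
      by (intro mult_right_mono v_nonneg)
    moreover have "mollifier_deriv a s x = 0" if "x \<notin> cball a (2 * r)"
      using that s by (intro mollifier_deriv_eq_0) auto
    ultimately show "\<bar>mollifier_deriv a s x * v x\<bar> \<le> B * (indicator (cball a (2 * r)) x *\<^sub>R v x)"
      using v_nonneg[of x] by (auto simp: abs_mult indicator_def)
  next
    show "integrable lborel (\<lambda>x. B * (indicator (cball a (2 * r)) x *\<^sub>R v x))"
      using v_locally_integrable[OF compact_cball, of a "2 * r"] by (simp add: set_integrable_def)
    show "(\<lambda>x. mollifier_deriv a r x * v x) \<in> borel_measurable lborel"
      using borel_measurable_mollifier_deriv[of a r] by (intro borel_measurable_times) auto
  qed (use r in auto)
qed

section \<open>Monotonicity of the means in the scale\<close>

lemma integral_bump_kernel_ge: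
  assumes r: "r > 0" and g: "AE x in lborel. dist a x < r \<longrightarrow> - K * v x \<le> g x"
  shows "- K * (LINT x|lborel. bump_kernel a r x * v x) \<le> (LINT x|lborel. bump_kernel a r x * g x)"
proof -
  have "- K * (LINT x|lborel. bump_kernel a r x * v x) = (LINT x|lborel. - K * (bump_kernel a r x * v x))"
    by simp
  also have "\<dots> \<le> (LINT x|lborel. bump_kernel a r x * g x)"
  proof (rule integral_mono_AE)
    show "AE x in lborel. - K * (bump_kernel a r x * v x) \<le> bump_kernel a r x * g x"
      using g
    proof (rule AE_mp, intro AE_I2 impI)
      fix x assume x: "dist a x < r \<longrightarrow> - K * v x \<le> g x"
      show "- K * (bump_kernel a r x * v x) \<le> bump_kernel a r x * g x"
      proof (cases "dist a x < r")
        case True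
        with x have "bump_kernel a r x * (- K * v x) \<le> bump_kernel a r x * g x"
          by (intro mult_left_mono bump_kernel_nonneg r) auto
        then show ?thesis by (simp add: mult_ac)
      qed (simp add: bump_kernel_eq_0 r)
    qed
  qed (auto intro!: integrable_bump_kernel_mult r v_locally_integrable g_locally_integrable)
  finally show ?thesis .
qed

text \<open>Also applied with negative \<open>K\<close>, far out where \<open>g\<close> is below a
  negative multiple of \<open>v\<close>.\<close>

lemma integral_bump_kernel_le:
  assumes r: "r > 0" and g: "AE x in lborel. dist a x < r \<longrightarrow> g x \<le> K * v x"
  shows "(LINT x|lborel. bump_kernel a r x * g x) \<le> K * (LINT x|lborel. bump_kernel a r x * v x)"
proof -
  have "(LINT x|lborel. bump_kernel a r x * g x) \<le> (LINT x|lborel. K * (bump_kernel a r x * v x))"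
  proof (rule integral_mono_AE)
    show "AE x in lborel. bump_kernel a r x * g x \<le> K * (bump_kernel a r x * v x)"
      using g
    proof (rule AE_mp, intro AE_I2 impI)
      fix x assume x: "dist a x < r \<longrightarrow> g x \<le> K * v x"
      show "bump_kernel a r x * g x \<le> K * (bump_kernel a r x * v x)"
      proof (cases "dist a x < r")
        case True
        with x have "bump_kernel a r x * g x \<le> bump_kernel a r x * (K * v x)"
          by (intro mult_left_mono bump_kernel_nonneg r) auto
        then show ?thesis by (simp add: mult_ac)
      qed (simp add: bump_kernel_eq_0 r)
    qed
  qed (auto intro!: integrable_bump_kernel_mult r v_locally_integrable g_locally_integrable)
  also have "\<dots> = K * (LINT x|lborel. bump_kernel a r x * v x)" by simp
  finally show ?thesis .
qed

lemma integral_bump_kernel_le_mean: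
  assumes r: "r > 0"
  shows "(LINT x|lborel. bump_kernel a r x * v x) \<le> r / 2 * mean r a"
proof -
  have "(LINT x|lborel. bump_kernel a r x * v x) \<le> (LINT x|lborel. r / 2 * (mollifier a r x * v x))"
  proof (rule integral_mono_AE)
    have "bump_kernel a r x * v x \<le> r / 2 * (mollifier a r x * v x)" for x
      using mult_right_mono[OF bump_kernel_le_mollifier[OF r, of a x] v_nonneg[of x]] by (simp add: mult_ac)
    then show "AE x in lborel. bump_kernel a r x * v x \<le> r / 2 * (mollifier a r x * v x)" by simp
  qed (use r v_locally_integrable in \<open>simp_all add: integrable_bump_kernel_mult integrable_mollifier_mult\<close>)
  then show ?thesis by (simp add: mean_def)
qed

text \<open>A Gronwall argument: the kernel bounds show that the derivative of the mean in
  \<open>r\<close> is at least \<open>- (K / 2) * r\<close> times the mean, and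
  \<open>exp (K / 4 * r\<^sup>2)\<close> is the integrating factor.\<close>

lemma mean_exp_mono:
  assumes r: "0 < r" "r \<le> s" and K: "K \<ge> 0"
    and g: "AE x in lborel. dist a x < s \<longrightarrow> - K * v x \<le> g x"
  shows "mean r a * exp (K / 4 * r\<^sup>2) \<le> mean s a * exp (K / 4 * s\<^sup>2)"
proof (rule DERIV_nonneg_imp_nondecreasing[OF r(2)])
  fix t assume t: "r \<le> t" "t \<le> s"
  define D where "D = (LINT x|lborel. bump_kernel a t x * g x)"
  have t0: "t > 0" using t r by simp
  have "AE x in lborel. dist a x < t \<longrightarrow> - K * v x \<le> g x"
    using g by (rule AE_mp) (use t in auto)
  from integral_bump_kernel_ge[OF t0 this]
  have "- K * (LINT x|lborel. bump_kernel a t x * v x) \<le> D" unfolding D_def .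
  moreover have "K * (LINT x|lborel. bump_kernel a t x * v x) \<le> K * (t / 2 * mean t a)"
    by (rule mult_left_mono[OF integral_bump_kernel_le_mean[OF t0] K])
  ultimately have "0 \<le> D + K / 2 * t * mean t a" by simp
  then have "0 \<le> (D + K / 2 * t * mean t a) * exp (K / 4 * t\<^sup>2)" by simp
  moreover have "((\<lambda>t. mean t a * exp (K / 4 * t\<^sup>2)) has_real_derivative
      (D + K / 2 * t * mean t a) * exp (K / 4 * t\<^sup>2)) (at t)"
    using mean_has_derivative[OF t0, of a, folded D_def]
    by (auto intro!: derivative_eq_intros simp: algebra_simps)
  ultimately show "\<exists>y. ((\<lambda>t. mean t a * exp (K / 4 * t\<^sup>2)) has_real_derivative y) (at t) \<and> 0 \<le> y"
    by blast
qed

text \<open>The reverse Gronwall estimate, from an upper bound on \<open>g\<close>. In particular, a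
  mean that vanishes at one scale vanishes at the larger ones covered by the bound.\<close>

lemma mean_exp_antimono:
  assumes r: "0 < r" "r \<le> s" and K: "K \<ge> 0"
    and g: "AE x in lborel. dist a x < s \<longrightarrow> g x \<le> K * v x"
  shows "mean s a * exp (- (K / 4) * s\<^sup>2) \<le> mean r a * exp (- (K / 4) * r\<^sup>2)"
proof (rule DERIV_nonpos_imp_nonincreasing[OF r(2)])
  fix t assume t: "r \<le> t" "t \<le> s"
  define D where "D = (LINT x|lborel. bump_kernel a t x * g x)"
  have t0: "t > 0" using t r by simp
  have "AE x in lborel. dist a x < t \<longrightarrow> g x \<le> K * v x"
    using g by (rule AE_mp) (use t in auto)
  from integral_bump_kernel_le[OF t0 this]
  have "D \<le> K * (LINT x|lborel. bump_kernel a t x * v x)" unfolding D_def .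
  moreover have "K * (LINT x|lborel. bump_kernel a t x * v x) \<le> K * (t / 2 * mean t a)"
    by (rule mult_left_mono[OF integral_bump_kernel_le_mean[OF t0] K])
  ultimately have "D - K / 2 * t * mean t a \<le> 0" by simp
  then have "(D - K / 2 * t * mean t a) * exp (- (K / 4) * t\<^sup>2) \<le> 0"
    by (intro mult_nonpos_nonneg) auto
  moreover have "((\<lambda>t. mean t a * exp (- (K / 4) * t\<^sup>2)) has_real_derivative
      (D - K / 2 * t * mean t a) * exp (- (K / 4) * t\<^sup>2)) (at t)"
    using mean_has_derivative[OF t0, of a, folded D_def]
    by (auto intro!: derivative_eq_intros simp: algebra_simps)
  ultimately show "\<exists>y. ((\<lambda>t. mean t a * exp (- (K / 4) * t\<^sup>2)) has_real_derivative y) (at t) \<and> y \<le> 0"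
    by blast
qed

section \<open>Boundedness, decay and continuity of the means\<close>

text \<open>Young's inequality with parameter \<open>\<eta>\<close> under the integral, one factor
  of the squared mollifier being bounded by \<open>24\<close>. A small \<open>\<eta>\<close> makes
  the first summand small and leaves only the mass of the square of \<open>v\<close> near
  \<open>a\<close>.\<close>

lemma mean_bound_square:
  assumes v2: "integrable lborel (\<lambda>x. (v x)\<^sup>2)" and \<eta>: "\<eta> > 0"
  shows "mean 1 a \<le> 12 * \<eta> * mollifier_mass TYPE('n) + (LINT x|lborel. indicator (cball a 1) x * (v x)\<^sup>2) / (2 * \<eta>)"
proof -
  have "mollifier a 1 x * v x \<le> 12 * \<eta> * mollifier a 1 x + indicator (cball a 1) x * (v x)\<^sup>2 / (2 * \<eta>)" for x
  proof (cases "dist a x < 1")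
    case True
    define p q where "p = mollifier a 1 x" and "q = v x"
    have "0 \<le> (\<eta> * p - q)\<^sup>2" by simp
    then have "2 * \<eta> * (p * q) \<le> \<eta>\<^sup>2 * p\<^sup>2 + q\<^sup>2"
      by (simp add: power2_eq_square algebra_simps)
    moreover have "\<eta>\<^sup>2 * (p * p) \<le> \<eta>\<^sup>2 * (24 * p)"
      using mollifier_bound[of 1 a x] mollifier_nonneg[of 1 a x]
      by (intro mult_left_mono mult_right_mono) (auto simp: p_def fact_numeral)
    ultimately have "2 * \<eta> * (p * q) \<le> \<eta>\<^sup>2 * (24 * p) + q\<^sup>2"
      by (simp add: power2_eq_square)
    then have "p * q \<le> 12 * \<eta> * p + q\<^sup>2 / (2 * \<eta>)"
      using \<eta> by (simp add: field_simps power2_eq_square)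
    then show ?thesis using True by (simp add: p_def q_def)
  next
    case False
    then show ?thesis using \<eta> by (simp add: mollifier_eq_0)
  qed
  then have "mean 1 a \<le> (LINT x|lborel. 12 * \<eta> * mollifier a 1 x + indicator (cball a 1) x * (v x)\<^sup>2 / (2 * \<eta>))"
    unfolding mean_def
    by (intro integral_mono_AE AE_I2 integrable_mollifier_mult v_locally_integrable
        Bochner_Integration.integrable_add integrable_mult_right integrable_mollifier
        integrable_divide integrable_real_mult_indicator[of _ _ "\<lambda>x. (v x)\<^sup>2", simplified mult.commute] v2) auto
  also have "\<dots> = 12 * \<eta> * mollifier_mass TYPE('n) + (LINT x|lborel. indicator (cball a 1) x * (v x)\<^sup>2) / (2 * \<eta>)"
    using integrable_mollifier[of 1 a] integral_mollifier[of 1 a]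
      integrable_mult_indicator[OF _ v2, of "cball a 1"] by (simp add: mult.assoc)
  finally show ?thesis .
qed

lemma mean_bounded:
  assumes v2: "integrable lborel (\<lambda>x. (v x)\<^sup>2)"
  shows "\<exists>B. \<forall>a. mean 1 a \<le> B"
proof (intro exI allI)
  fix a
  have "(LINT x|lborel. indicator (cball a 1) x * (v x)\<^sup>2) \<le> (LINT x|lborel. (v x)\<^sup>2)"
    using v2 integrable_mult_indicator[OF _ v2, of "cball a 1"]
    by (intro integral_mono_AE) (auto simp: indicator_def)
  then show "mean 1 a \<le> 12 * 1 * mollifier_mass TYPE('n) + (LINT x|lborel. (v x)\<^sup>2) / (2 * 1)"
    using mean_bound_square[OF v2 zero_less_one, of a] by simp
qed

lemma mean_vanishes_at_infinity:
  assumes v2: "integrable lborel (\<lambda>x. (v x)\<^sup>2)" and \<epsilon>: "\<epsilon> > 0"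
  shows "\<exists>R. \<forall>a. norm a \<ge> R \<longrightarrow> mean 1 a \<le> \<epsilon>"
proof -
  \<comment> \<open>Makes the first summand in \<open>mean_bound_square\<close> equal to
    \<open>\<epsilon> / 2\<close>; a tail below \<open>\<epsilon> * \<eta>\<close> bounds the second
    one by \<open>\<epsilon> / 2\<close>.\<close>
  define \<eta> where "\<eta> = \<epsilon> / (24 * mollifier_mass TYPE('n))"
  have \<eta>: "\<eta> > 0" "12 * \<eta> * mollifier_mass TYPE('n) = \<epsilon> / 2"
    using \<epsilon> mollifier_mass_pos[where 'n = 'n] by (auto simp: \<eta>_def)
  let ?T = "\<lambda>n x. indicator {x. norm x \<ge> real n} x * (v x)\<^sup>2"
  have T: "integrable lborel (?T n)" for n
    using integrable_mult_indicator[OF _ v2, of "{x. norm x \<ge> real n}"] by simp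
  have "(\<lambda>n. LINT x|lborel. ?T n x) \<longlonglongrightarrow> (LINT x|(lborel :: (real^'n) measure). 0)"
  proof (rule integral_dominated_convergence[where w = "\<lambda>x. (v x)\<^sup>2"])
    show "AE x in lborel. (\<lambda>n. ?T n x) \<longlonglongrightarrow> 0"
    proof (intro AE_I2 tendsto_eventually)
      fix x :: "real^'n"
      obtain N where "norm x < real N" using reals_Archimedean2 by blast
      then have "?T n x = 0" if "n \<ge> N" for n using that by (auto simp: indicator_def)
      then show "\<forall>\<^sub>F n in sequentially. ?T n x = 0" by (auto simp: eventually_sequentially)
    qed
  qed (use v2 in \<open>auto simp: indicator_def\<close>)
  then have "\<forall>\<^sub>F n in sequentially. (LINT x|lborel. ?T n x) < \<epsilon> * \<eta>"
    using \<eta> \<epsilon> by (intro order_tendstoD(2)) auto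
  then obtain N where N: "(LINT x|lborel. ?T N x) < \<epsilon> * \<eta>"
    by (auto simp: eventually_sequentially)
  show ?thesis
  proof (intro exI allI impI)
    \<comment> \<open>The extra \<open>1\<close> keeps the unit ball about \<open>a\<close> in the
      region of the tail integral.\<close>
    fix a :: "real^'n" assume a: "norm a \<ge> real N + 1"
    have "cball a 1 \<subseteq> {x. norm x \<ge> real N}"
    proof
      fix x assume "x \<in> cball a 1"
      then show "x \<in> {x. norm x \<ge> real N}"
        using a norm_triangle_ineq2[of a x] by (simp add: dist_norm)
    qed
    then have "(LINT x|lborel. indicator (cball a 1) x * (v x)\<^sup>2) \<le> (LINT x|lborel. ?T N x)"
      using T integrable_mult_indicator[OF _ v2, of "cball a 1"]
      by (intro integral_mono_AE) (auto simp: indicator_def subset_iff intro!: AE_I2)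
    also have "\<dots> \<le> \<epsilon> * \<eta>" using N by simp
    finally have "(LINT x|lborel. indicator (cball a 1) x * (v x)\<^sup>2) / (2 * \<eta>) \<le> \<epsilon> / 2"
      using \<eta>(1) by (simp add: field_simps)
    then show "mean 1 a \<le> \<epsilon>"
      using mean_bound_square[OF v2 \<eta>(1), of a] \<eta>(2) by linarith
  qed
qed

text \<open>Dominated convergence: for centres within distance \<open>1\<close> of \<open>a\<close>,
  all integrands are supported in the ball of radius \<open>r + 1\<close> about
  \<open>a\<close>.\<close>

lemma continuous_on_mean:
  assumes r: "r > 0"
  shows "continuous_on UNIV (mean r)"
proof (intro continuous_at_imp_continuous_on ballI)
  fix a :: "real^'n"
  show "isCont (mean r) a"
    unfolding continuous_at_sequentially comp_def
  proof (intro allI impI)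
    fix X :: "nat \<Rightarrow> real^'n" assume X: "X \<longlonglongrightarrow> a"
    have "\<forall>\<^sub>F n in sequentially. dist (X n) a < 1"
      using X by (rule tendstoD) simp
    then obtain N where N: "\<And>n. n \<ge> N \<Longrightarrow> dist (X n) a < 1"
      by (auto simp: eventually_sequentially)
    let ?B = "fact 4 / r ^ CARD('n)"
    have "(\<lambda>n. mean r (X (n + N))) \<longlonglongrightarrow> mean r a"
      unfolding mean_def
    proof (rule integral_dominated_convergence[where w = "\<lambda>x. ?B * (indicator (cball a (r + 1)) x *\<^sub>R v x)"])
      show "integrable lborel (\<lambda>x. ?B * (indicator (cball a (r + 1)) x *\<^sub>R v x))"
        using v_locally_integrable[OF compact_cball, of a "r + 1"] by (simp add: set_integrable_def)
      show "AE x in lborel. (\<lambda>n. mollifier (X (n + N)) r x * v x) \<longlonglongrightarrow> mollifier a r x * v x"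
      proof (intro AE_I2 tendsto_mult tendsto_const)
        fix x :: "real^'n"
        have "continuous_on UNIV (mollifier x r)"
          unfolding mollifier_def[abs_def] using r by (intro continuous_intros) auto
        then have "(\<lambda>n. mollifier x r (X (n + N))) \<longlonglongrightarrow> mollifier x r a"
          by (rule continuous_on_tendsto_compose) (auto intro: LIMSEQ_ignore_initial_segment X)
        then show "(\<lambda>n. mollifier (X (n + N)) r x) \<longlonglongrightarrow> mollifier a r x"
          by (simp only: mollifier_symmetric[of _ r x])
      qed
      show "AE x in lborel. norm (mollifier (X (n + N)) r x * v x) \<le> ?B * (indicator (cball a (r + 1)) x *\<^sub>R v x)" for n
      proof (rule AE_I2)
        fix x
        have "dist (X (n + N)) a < 1" by (rule N) simp
        then have "mollifier (X (n + N)) r x = 0" if "x \<notin> cball a (r + 1)"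
          using that dist_triangle3[of a x "X (n + N)"] by (intro mollifier_eq_0[OF r]) auto
        moreover have "\<bar>mollifier (X (n + N)) r x\<bar> * v x \<le> ?B * v x"
          by (intro mult_right_mono mollifier_bound[OF r] v_nonneg)
        ultimately show "norm (mollifier (X (n + N)) r x * v x) \<le> ?B * (indicator (cball a (r + 1)) x *\<^sub>R v x)"
          using v_nonneg[of x] by (auto simp: indicator_def abs_mult)
      qed
    qed measurable
    then show "(\<lambda>n. mean r (X n)) \<longlonglongrightarrow> mean r a"
      by (rule LIMSEQ_offset)
  qed
qed

section \<open>Pointwise values as limits of means\<close>

text \<open>Once convergence is known, this is an everywhere defined representative of
  \<open>mollifier_mass\<close> times \<open>v\<close>, the means not being normalized.\<close>

definition point_value :: "real^'n \<Rightarrow> real" where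
  "point_value a = lim (\<lambda>n. mean (1 / Suc n) a)"

lemma eventually_inverse_Suc_le: "s > 0 \<Longrightarrow> \<forall>\<^sub>F n in sequentially. 1 / real (Suc n) \<le> s"
  using order_tendstoD(2)[OF LIMSEQ_inverse_real_of_nat, of s]
  by (auto elim!: eventually_mono simp: inverse_eq_divide)

context
  fixes K B :: real
  assumes K: "K \<ge> 0"
    and g_ge: "AE x in lborel. - K * v x \<le> g x"
    and mean_le_B: "\<And>a. mean 1 a \<le> B"
begin

lemma g_ge_ball: "AE x in lborel. dist a x < r \<longrightarrow> - K * v x \<le> g x"
  using g_ge by (rule AE_mp) auto

text \<open>Multiplied by the integrating factor, the means are nonnegative and decrease as the
  scale shrinks, so they converge; the factor itself tends to \<open>1\<close>.\<close>

lemma point_value_tendsto: "(\<lambda>n. mean (1 / Suc n) a) \<longlonglongrightarrow> point_value a"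
proof -
  define X where "X n = mean (1 / Suc n) a * exp (K / 4 * (1 / Suc n)\<^sup>2)" for n
  have "X n \<le> X m" if "m \<le> n" for m n
    unfolding X_def by (rule mean_exp_mono[OF _ _ K g_ge_ball]) (use that in \<open>auto simp: field_simps\<close>)
  then have "decseq X" by (simp add: decseq_def)
  moreover have "\<forall>n. 0 \<le> X n"
    unfolding X_def by (auto intro!: mult_nonneg_nonneg mean_nonneg)
  ultimately obtain L where L: "X \<longlonglongrightarrow> L" by (rule decseq_convergent)
  have "(\<lambda>n. X n * exp (- (K / 4) * (1 / Suc n)\<^sup>2)) \<longlonglongrightarrow> L * exp (- (K / 4) * 0\<^sup>2)"
    by (intro tendsto_intros L lim_1_over_n[THEN LIMSEQ_Suc])
  moreover have "X n * exp (- (K / 4) * (1 / Suc n)\<^sup>2) = mean (1 / Suc n) a" for n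
    by (simp add: X_def mult.assoc flip: exp_add)
  ultimately have "(\<lambda>n. mean (1 / Suc n) a) \<longlonglongrightarrow> L" by simp
  then show ?thesis
    unfolding point_value_def by (metis limI)
qed

lemma mean_le:
  assumes "0 < r" "r \<le> 1"
  shows "mean r a \<le> mean 1 a * exp (K / 4)"
proof -
  have "mean r a * 1 \<le> mean r a * exp (K / 4 * r\<^sup>2)"
    using assms K by (intro mult_left_mono mean_nonneg) auto
  also have "\<dots> \<le> mean 1 a * exp (K / 4 * 1\<^sup>2)"
    by (rule mean_exp_mono[OF assms K g_ge_ball])
  finally show ?thesis by simp
qed

lemma point_value_le_mean_1: "point_value a \<le> mean 1 a * exp (K / 4)"
  by (rule LIMSEQ_le_const2[OF point_value_tendsto]) (auto intro!: mean_le)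

lemma point_value_AE_eq: "AE x in lborel. point_value x = mollifier_mass TYPE('n) * v x"
proof (rule mollified_limit_AE_eq[where R = "\<lambda>n. 1 / Suc n" and B = "B * exp (K / 4)"])
  show "(LINT x|lborel. mollifier a (1 / Suc n) x * v x) \<le> B * exp (K / 4)" for n a
    using order_trans[OF mean_le[of "1 / Suc n" a] mult_right_mono[OF mean_le_B[of a], of "exp (K / 4)"]]
    by (simp add: mean_def)
  show "(\<lambda>n. LINT x|lborel. mollifier a (1 / Suc n) x * v x) \<longlonglongrightarrow> point_value a" for a
    using point_value_tendsto[of a] by (simp add: mean_def)
  show "(\<lambda>n. 1 / real (Suc n)) \<longlonglongrightarrow> 0"
    using LIMSEQ_inverse_real_of_nat by (simp add: inverse_eq_divide)
qed (auto simp: v_nonneg v_locally_integrable)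

text \<open>The local constant \<open>k\<close> is separate from the \<open>K\<close> of the
  context: \<open>k = 0\<close> gives the sub-mean-value property where \<open>g\<close> is
  nonnegative.\<close>

lemma point_value_le_mean:
  assumes "s > 0" "k \<ge> 0" "AE x in lborel. dist a x < s \<longrightarrow> - k * v x \<le> g x"
  shows "point_value a \<le> mean s a * exp (k / 4 * s\<^sup>2)"
proof (rule tendsto_upperbound[OF point_value_tendsto])
  show "\<forall>\<^sub>F n in sequentially. mean (1 / Suc n) a \<le> mean s a * exp (k / 4 * s\<^sup>2)"
    using eventually_inverse_Suc_le[OF assms(1)]
  proof eventually_elim
    case (elim n)
    have "mean (1 / Suc n) a * 1 \<le> mean (1 / Suc n) a * exp (k / 4 * (1 / Suc n)\<^sup>2)"
      using assms(2) by (intro mult_left_mono mean_nonneg) auto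
    also have "\<dots> \<le> mean s a * exp (k / 4 * s\<^sup>2)"
      by (rule mean_exp_mono[OF _ elim assms(2,3)]) simp
    finally show ?case by simp
  qed
qed simp

lemma point_value_ge_mean:
  assumes "s > 0" "k \<ge> 0" "AE x in lborel. dist a x < s \<longrightarrow> g x \<le> k * v x"
  shows "mean s a * exp (- (k / 4) * s\<^sup>2) \<le> point_value a"
proof (rule tendsto_lowerbound[OF point_value_tendsto])
  show "\<forall>\<^sub>F n in sequentially. mean s a * exp (- (k / 4) * s\<^sup>2) \<le> mean (1 / Suc n) a"
    using eventually_inverse_Suc_le[OF assms(1)]
  proof eventually_elim
    case (elim n)
    have "mean s a * exp (- (k / 4) * s\<^sup>2) \<le> mean (1 / Suc n) a * exp (- (k / 4) * (1 / Suc n)\<^sup>2)"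
      by (rule mean_exp_antimono[OF _ elim assms(2,3)]) simp
    also have "\<dots> \<le> mean (1 / Suc n) a * 1"
      using assms(2) by (intro mult_left_mono mean_nonneg) auto
    finally show ?case by simp
  qed
qed simp

text \<open>The means are continuous and converge uniformly. Mean and limit differ by a factor of at
  most \<open>E\<close> either way and neither exceeds \<open>M\<close>, so the error is at most
  \<open>M * (E - 1)\<close>.\<close>

lemma continuous_on_point_value:
  assumes g_le: "AE x in lborel. g x \<le> K * v x"
  shows "continuous_on UNIV point_value"
proof (rule uniform_limit_theorem)
  show "uniform_limit UNIV (\<lambda>n a. mean (1 / Suc n) a) point_value sequentially"
  proof (rule uniform_limitI)
    fix e :: real assume e: "e > 0"
    define M where "M = B * exp (K / 4)"
    have "(\<lambda>n. M * (exp (K / 4 * (1 / Suc n)\<^sup>2) - 1)) \<longlonglongrightarrow> M * (exp (K / 4 * 0\<^sup>2) - 1)"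
      by (intro tendsto_intros lim_1_over_n[THEN LIMSEQ_Suc])
    then have "\<forall>\<^sub>F n in sequentially. M * (exp (K / 4 * (1 / Suc n)\<^sup>2) - 1) < e"
      using e by (intro order_tendstoD(2)) auto
    then show "\<forall>\<^sub>F n in sequentially. \<forall>a\<in>UNIV. dist (mean (1 / Suc n) a) (point_value a) < e"
    proof eventually_elim
      case (elim n)
      define E where "E = exp (K / 4 * (1 / Suc n)\<^sup>2)"
      have E: "E \<ge> 1" using K by (simp add: E_def)
      show ?case
      proof
        fix a
        define p m where "p = point_value a" and "m = mean (1 / Suc n) a"
        have "mean 1 a * exp (K / 4) \<le> M"
          unfolding M_def by (intro mult_right_mono mean_le_B) simp
        then have M: "p \<le> M" "m \<le> M"
          using point_value_le_mean_1[of a] mean_le[of "1 / Suc n" a] by (auto simp: p_def m_def)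
        have "AE x in lborel. dist a x < 1 / Suc n \<longrightarrow> g x \<le> K * v x"
          using g_le by (rule AE_mp) auto
        from point_value_ge_mean[OF _ K this] have "m * inverse E \<le> p"
          by (simp add: p_def m_def E_def exp_minus)
        then have "m \<le> p * E"
          using E by (simp add: field_simps)
        moreover have "p \<le> m * E"
          unfolding p_def m_def E_def by (rule point_value_le_mean[OF _ K g_ge_ball]) simp
        moreover have "m * (E - 1) \<le> M * (E - 1)" "p * (E - 1) \<le> M * (E - 1)"
          using E M by (auto intro!: mult_right_mono)
        ultimately have "\<bar>m - p\<bar> \<le> M * (E - 1)"
          by (simp add: algebra_simps abs_le_iff)
        then show "dist (mean (1 / Suc n) a) (point_value a) < e"
          using elim by (simp add: dist_real_def p_def m_def E_def)
      qed
    qed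
  qed
qed (auto intro!: always_eventually continuous_on_mean)

end

section \<open>Vanishing of solutions and the maximum principle\<close>

lemma vanishes_if_concave_at_infinity:
  assumes K: "K \<ge> 0" "AE x in lborel. g x \<le> K * v x"
    and \<epsilon>: "\<epsilon> > 0" "AE x in lborel. norm x \<ge> R\<^sub>0 \<longrightarrow> g x \<le> - \<epsilon> * v x"
  shows "AE x in lborel. v x = 0"
proof -
  obtain C where C: "C > 0"
    "\<And>a (x::real^'n) r. r > 0 \<Longrightarrow> mollifier_deriv a r x \<ge> - (C / r\<^sup>2) * bump_kernel a r x"
    using mollifier_deriv_ge_bump_kernel[where 'n = 'n] by blast
  \<comment> \<open>The radius at which the constant \<open>C / R\<^sup>2\<close> of the kernel is
    \<open>\<epsilon> / 2\<close>, strictly below \<open>\<epsilon>\<close>.\<close>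
  define R where "R = sqrt (2 * C / \<epsilon>)"
  have R: "R > 0" "C / R\<^sup>2 = \<epsilon> / 2" using C \<epsilon> by (auto simp: R_def)
  \<comment> \<open>Places the whole ball of radius \<open>R\<close> about \<open>a\<close> in the
    region \<open>norm x \<ge> R\<^sub>0\<close>.\<close>
  obtain a :: "real^'n" where a: "norm a = \<bar>R\<^sub>0\<bar> + R"
    using vector_choose_size[of "\<bar>R\<^sub>0\<bar> + R"] R by auto
  define I where "I = (LINT x|lborel. bump_kernel a R x * v x)"
  have "AE x in lborel. dist a x < R \<longrightarrow> g x \<le> (- \<epsilon>) * v x"
    using \<epsilon>(2)
  proof (rule AE_mp, intro AE_I2 impI)
    fix x assume "norm x \<ge> R\<^sub>0 \<longrightarrow> g x \<le> - \<epsilon> * v x" "dist a x < R"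
    then show "g x \<le> - \<epsilon> * v x"
      using a norm_triangle_ineq2[of a x] by (auto simp: dist_norm)
  qed
  from integral_bump_kernel_le[OF R(1) this]
  have "(LINT x|lborel. mollifier_deriv a R x * v x) \<le> - \<epsilon> * I"
    unfolding integral_mollifier_deriv[OF R(1)] I_def .
  moreover have "- (\<epsilon> / 2) * I \<le> (LINT x|lborel. mollifier_deriv a R x * v x)"
  proof -
    have "- (\<epsilon> / 2) * I = (LINT x|lborel. - (\<epsilon> / 2) * (bump_kernel a R x * v x))"
      by (simp add: I_def)
    also have "\<dots> \<le> (LINT x|lborel. mollifier_deriv a R x * v x)"
    proof (rule integral_mono_AE)
      have "- (\<epsilon> / 2) * (bump_kernel a R x * v x) \<le> mollifier_deriv a R x * v x" for x
        using mult_right_mono[OF C(2)[OF R(1), of a x] v_nonneg[of x]] by (simp add: R(2))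
      then show "AE x in lborel. - (\<epsilon> / 2) * (bump_kernel a R x * v x) \<le> mollifier_deriv a R x * v x"
        by simp
    qed (use R v_locally_integrable in
        \<open>auto intro!: integrable_mult_right integrable_bump_kernel_mult integrable_mollifier_deriv_mult\<close>)
    finally show ?thesis .
  qed
  \<comment> \<open>The same integral is at most \<open>- \<epsilon> * I\<close> and at least
    \<open>- (\<epsilon> / 2) * I\<close>, which leaves no room for a positive
    \<open>I\<close>.\<close>
  ultimately have "\<epsilon> / 2 * I \<le> 0" by simp
  then have "I \<le> 0" using \<epsilon>(1) by (simp add: mult_le_0_iff)
  then have "AE x in lborel. dist a x < R \<longrightarrow> v x = 0"
    unfolding I_def
    by (intro AE_ball_zero_of_integral[of "bump_kernel a R"] integrable_bump_kernel_mult
        bump_kernel_nonneg bump_kernel_pos R v_nonneg v_locally_integrable)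
  then have "AE x in lborel. mollifier a R x * v x = 0"
    by (rule AE_mp) (auto simp: mollifier_eq_0 R not_less)
  then have mean_0: "mean R a = 0"
    unfolding mean_def by (rule integral_eq_zero_AE)
  \<comment> \<open>The linear upper bound on \<open>g\<close> carries the zero mean from scale
    \<open>R\<close> to all larger scales, so \<open>v\<close> vanishes on balls that exhaust the
    space.\<close>
  have "AE x in lborel. dist a x < R + real n \<longrightarrow> v x = 0" for n
  proof -
    have s: "0 < R + real n" using R by simp
    have "AE x in lborel. dist a x < R + real n \<longrightarrow> g x \<le> K * v x"
      using K(2) by (rule AE_mp) auto
    from mean_exp_antimono[OF R(1) _ K(1) this]
    have "mean (R + real n) a \<le> 0" by (simp add: mean_0 mult_le_0_iff)
    then show ?thesis
      unfolding mean_def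
      by (intro AE_ball_zero_of_integral[of "mollifier a (R + real n)"] integrable_mollifier_mult
          mollifier_nonneg mollifier_pos s v_nonneg v_locally_integrable)
  qed
  then have "AE x in lborel. \<forall>n. dist a x < R + real n \<longrightarrow> v x = 0"
    by (subst AE_all_countable) blast
  then show ?thesis
  proof (rule AE_mp, intro AE_I2 impI)
    fix x assume x: "\<forall>n. dist a x < R + real n \<longrightarrow> v x = 0"
    obtain n where "dist a x < real n" using reals_Archimedean2 by blast
    then have "dist a x < R + real n" using R by simp
    then show "v x = 0" using x by blast
  qed
qed

text \<open>The strong maximum principle for the continuous function \<open>w = point_value\<close>:
  a value above \<open>c * \<beta>\<close> would yield a global maximum attained on a set both open
  and closed, against the decay of \<open>w\<close>.\<close>

lemma maximum_principle:
  assumes K: "K \<ge> 0" "AE x in lborel. - K * v x \<le> g x" "AE x in lborel. g x \<le> K * v x"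
    and v2: "integrable lborel (\<lambda>x. (v x)\<^sup>2)"
    and \<beta>: "\<beta> > 0" "AE x in lborel. v x > \<beta> \<longrightarrow> g x \<ge> 0"
  shows "AE x in lborel. v x \<le> \<beta>"
proof -
  obtain B where B: "\<And>a. mean 1 a \<le> B" using mean_bounded[OF v2] by auto
  note limit = K(1) K(2) B
  define c where "c = mollifier_mass TYPE('n)"
  define w where "w = point_value"
  have c: "c > 0" by (simp add: c_def mollifier_mass_pos)
  have wv: "AE x in lborel. w x = c * v x"
    unfolding w_def c_def by (rule point_value_AE_eq[OF limit])
  have cont: "continuous_on UNIV w"
    unfolding w_def by (rule continuous_on_point_value[OF limit K(3)])
  have "w a \<le> c * \<beta>" for a
  proof (rule ccontr)
    assume "\<not> w a \<le> c * \<beta>"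
    then have wa: "w a > c * \<beta>" by simp
    then have wa0: "w a > 0" using c \<beta>(1) by (meson less_trans mult_pos_pos)
    obtain R where R: "\<And>x. norm x \<ge> R \<Longrightarrow> mean 1 x \<le> w a / 2 * exp (- (K / 4))"
      using mean_vanishes_at_infinity[OF v2, of "w a / 2 * exp (- (K / 4))"] wa0 by auto
    have far: "w x < w a" if "norm x \<ge> R" for x
    proof -
      have "w x \<le> mean 1 x * exp (K / 4)"
        unfolding w_def by (rule point_value_le_mean_1[OF limit])
      also have "\<dots> \<le> w a / 2 * exp (- (K / 4)) * exp (K / 4)"
        using R[OF that] by (intro mult_right_mono) auto
      also have "\<dots> = w a / 2" by (simp add: mult.assoc flip: exp_add)
      finally show ?thesis using wa0 by simp
    qed
    \<comment> \<open>This ball contains \<open>a\<close> and all points to which \<open>far\<close>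
      does not apply, so the maximum over it is global.\<close>
    let ?D = "cball (0::real^'n) (max \<bar>R\<bar> (norm a))"
    obtain x0 where x0: "x0 \<in> ?D" "\<And>x. x \<in> ?D \<Longrightarrow> w x \<le> w x0"
      using continuous_attains_sup[of ?D w] continuous_on_subset[OF cont]
      by (metis compact_cball empty_iff mem_cball_0 max.cobounded2 subset_UNIV)
    define M where "M = w x0"
    have Ma: "w a \<le> M" unfolding M_def by (rule x0) simp
    have wM: "w x \<le> M" for x
    proof (cases "x \<in> ?D")
      case False
      then have "norm x \<ge> R" by auto
      then show ?thesis using far Ma by fastforce
    qed (use x0 in \<open>simp add: M_def\<close>)
    define T where "T = {x. w x = M}"
    have "closed T"
      unfolding T_def by (intro closed_Collect_eq cont continuous_on_const)
    moreover have "open T"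
      unfolding open_contains_ball
    proof
      fix x assume x: "x \<in> T"
      have "open {x. c * \<beta> < w x}"
        by (intro open_Collect_less cont continuous_on_const)
      moreover have "x \<in> {x. c * \<beta> < w x}" using x wa Ma by (simp add: T_def)
      ultimately obtain r where r: "r > 0" "ball x r \<subseteq> {x. c * \<beta> < w x}" by (rule openE)
      \<comment> \<open>Near \<open>x\<close> one has \<open>w > c * \<beta>\<close>, that is
        \<open>v > \<beta>\<close> almost everywhere; hence \<open>g \<ge> 0\<close> there, and the
        sub-mean-value property follows with constant \<open>0\<close>.\<close>
      have "AE y in lborel. dist x y < r \<longrightarrow> - 0 * v y \<le> g y"
        using wv \<beta>(2)
      proof eventually_elim
        case (elim y)
        show ?case
        proof
          assume "dist x y < r"
          then have "c * \<beta> < w y" using r(2) by auto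
          then have "v y > \<beta>" using elim(1) c by simp
          then show "- 0 * v y \<le> g y" using elim(2) by simp
        qed
      qed
      from point_value_le_mean[OF limit r(1) order_refl this]
      have "M \<le> mean r x" using x by (simp add: T_def w_def)
      have int: "integrable lborel (\<lambda>y. mollifier x r y * v y)" "integrable lborel (mollifier x r)"
        using r(1) v_locally_integrable by (auto intro!: integrable_mollifier_mult integrable_mollifier)
      \<comment> \<open>The weighted integral of the nonnegative \<open>M - w\<close> equals
        \<open>c * (M - mean r x)\<close>, which is at most \<open>0\<close>; so
        \<open>w = M\<close> almost everywhere in the ball.\<close>
      have AE_int: "AE y in lborel. mollifier x r y * (M - w y) = M * mollifier x r y - c * (mollifier x r y * v y)"
        using wv by eventually_elim (simp add: algebra_simps)
      have w_meas [measurable]: "w \<in> borel_measurable borel"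
        by (rule borel_measurable_continuous_onI[OF cont])
      have m_meas [measurable]: "mollifier x r \<in> borel_measurable borel"
        using borel_measurable_integrable[OF int(2)] by simp
      have "integrable lborel (\<lambda>y. mollifier x r y * (M - w y))"
        by (rule integrable_cong_AE[THEN iffD2, OF _ _ AE_int]) (use int in auto)
      moreover have "(LINT y|lborel. mollifier x r y * (M - w y))
          = (LINT y|lborel. M * mollifier x r y - c * (mollifier x r y * v y))"
        by (rule integral_cong_AE[OF _ _ AE_int]) measurable
      then have "(LINT y|lborel. mollifier x r y * (M - w y)) = M * c - c * mean r x"
        using int integral_mollifier[OF r(1), of x] by (simp add: mean_def c_def)
      then have "(LINT y|lborel. mollifier x r y * (M - w y)) \<le> 0"
        using mult_left_mono[OF \<open>M \<le> mean r x\<close>, of c] c by (simp add: mult.commute)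
      ultimately have "AE y in lborel. dist x y < r \<longrightarrow> M - w y = 0"
        by (intro AE_ball_zero_of_integral[of "mollifier x r"] mollifier_nonneg mollifier_pos r)
           (use wM in auto)
      then have null: "AE y in lborel. y \<notin> ball x r \<inter> {y. w y < M}"
        by (rule AE_mp) auto
      \<comment> \<open>Continuity upgrades this to every point, since a nonempty open set is not
        negligible.\<close>
      have "open (ball x r \<inter> {y. w y < M})"
        by (intro open_Int open_ball open_Collect_less cont continuous_on_const)
      moreover from this have "ball x r \<inter> {y. w y < M} \<in> null_sets lborel"
        using null by (subst AE_iff_null_sets) auto
      then have "negligible (ball x r \<inter> {y. w y < M})"
        by (simp add: negligible_iff_null_sets null_sets_completionI)
      ultimately have "ball x r \<inter> {y. w y < M} = {}"
        using open_not_negligible by blast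
      then have "\<not> w y < M" if "y \<in> ball x r" for y using that by blast
      then have "ball x r \<subseteq> T" using wM by (auto simp: T_def not_less intro: antisym)
      then show "\<exists>r>0. ball x r \<subseteq> T" using r(1) by blast
    qed
    ultimately have "T = {} \<or> T = UNIV" using clopen by blast
    moreover have "x0 \<in> T" by (simp add: T_def M_def)
    ultimately have "T = UNIV" by auto
    moreover obtain z :: "real^'n" where "norm z = \<bar>R\<bar>" using vector_choose_size[of "\<bar>R\<bar>"] by auto
    ultimately have "w z = M" "w z < w a" using far[of z] by (auto simp: T_def)
    then show False using Ma by simp
  qed
  note w_le = this
  show ?thesis
    using wv
  proof eventually_elim
    case (elim x)
    then have "c * v x \<le> c * \<beta>" using w_le[of x] by simp
    then show ?case using c by simp
  qed
qed

end

section \<open>The nonlinearity\<close>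

locale nonlinearity =
  fixes F :: "real \<Rightarrow> real" and \<beta>\<^sub>0 :: real
  assumes smooth_F: "smooth_plus F"
    and W_ii_F: "W_ii F"
    and \<beta>\<^sub>0_pos: "\<beta>\<^sub>0 > 0"
    and N_mono: "\<forall>s>\<beta>\<^sub>0. deriv_plus (nonlinear_part F) s \<ge> 0"
begin

abbreviation D :: "real \<Rightarrow> real" where
  "D \<equiv> deriv_plus F"

lemma not_trivial_at_within: "s \<ge> 0 \<Longrightarrow> at s within {0::real..} \<noteq> bot"
proof -
  assume "s \<ge> 0"
  then have "s islimpt {s..s + 1}" by (simp add: islimpt_Icc)
  then have "s islimpt {0..}" by (rule islimpt_subset) (use \<open>s \<ge> 0\<close> in auto)
  then show ?thesis by (simp add: trivial_limit_within)
qed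

lemma deriv_plus_works:
  assumes "f differentiable (at s within {0..})"
  shows "(f has_real_derivative deriv_plus f s) (at s within {0..})"
  using assms unfolding deriv_plus_def has_real_derivative_iff_has_vector_derivative
  by (rule vector_derivative_works[THEN iffD1])

lemma F_deriv: "s \<ge> 0 \<Longrightarrow> (F has_real_derivative D s) (at s within {0..})"
  using smooth_F unfolding smooth_plus_def by (intro deriv_plus_works) (metis funpow_0)

lemma D_deriv: "s \<ge> 0 \<Longrightarrow> (D has_real_derivative deriv_plus D s) (at s within {0..})"
  using smooth_F[unfolded smooth_plus_def, rule_format, of s 1] by (intro deriv_plus_works) simp

lemma D_continuous: "continuous_on {0..} D"
  using D_deriv by (intro DERIV_continuous_on) auto

lemma D_0: "D 0 = 0"
  using W_ii_F by (simp add: W_ii_def)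

text \<open>\<open>N'(s) = D s - s\<close>, derivatives within \<open>{0..}\<close> being
  unique.\<close>

lemma D_ge_id: "s > \<beta>\<^sub>0 \<Longrightarrow> D s \<ge> s"
proof -
  assume s: "s > \<beta>\<^sub>0"
  then have s0: "s \<ge> 0" using \<beta>\<^sub>0_pos by simp
  have "(nonlinear_part F has_real_derivative D s - s) (at s within {0..})"
    unfolding nonlinear_part_def[abs_def]
    by (rule derivative_eq_intros F_deriv[OF s0] refl | simp)+
  then have "deriv_plus (nonlinear_part F) s = D s - s"
    unfolding deriv_plus_def has_real_derivative_iff_has_vector_derivative
    by (rule vector_derivative_within[OF not_trivial_at_within[OF s0]])
  then show ?thesis using N_mono s by force
qed

text \<open>\<open>W''(0) = 1\<close> together with \<open>D 0 = 0\<close> makes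
  \<open>D s / s\<close> tend to \<open>1\<close> at \<open>0\<close>.\<close>

lemma D_near_0:
  assumes "\<epsilon> > 0"
  shows "\<exists>\<delta>>0. \<forall>s. 0 \<le> s \<and> s \<le> \<delta> \<longrightarrow> \<bar>D s - s\<bar> \<le> \<epsilon> * s"
proof -
  have "(D has_real_derivative 1) (at 0 within {0..})"
    using D_deriv[of 0] W_ii_F by (simp add: W_ii_def)
  then have "((\<lambda>s. (D s - D 0) / (s - 0)) \<longlongrightarrow> 1) (at 0 within {0..})"
    unfolding has_field_derivative_iff .
  then have "\<forall>\<^sub>F s in at 0 within {0..}. dist (D s / s) 1 < \<epsilon>"
    using assms by (intro tendstoD) (auto simp: D_0)
  then obtain d where d: "d > 0" "\<And>s. s \<in> {0..} \<Longrightarrow> s \<noteq> 0 \<Longrightarrow> dist s 0 < d \<Longrightarrow> dist (D s / s) 1 < \<epsilon>"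
    unfolding eventually_at by blast
  have "\<bar>D s - s\<bar> \<le> \<epsilon> * s" if "0 \<le> s" "s \<le> d / 2" for s
  proof (cases "s = 0")
    case False
    then have s: "s > 0" using that by simp
    then have "\<bar>D s / s - 1\<bar> < \<epsilon>" using d(2)[of s] d(1) that by (simp add: dist_real_def)
    moreover have "D s / s - 1 = (D s - s) / s" using s by (simp add: field_simps)
    ultimately show ?thesis using s by (simp add: field_simps)
  qed (simp add: D_0)
  then show ?thesis using d(1) by (intro exI[of _ "d / 2"]) auto
qed

text \<open>Close to \<open>0\<close> this is \<open>D_near_0\<close>; on the rest of the interval
  \<open>D\<close> is bounded by compactness, and \<open>s > \<delta>\<close> turns the bound into a
  linear one.\<close>

lemma D_linear_bound: "\<exists>K\<ge>0. \<forall>s. 0 \<le> s \<and> s \<le> M \<longrightarrow> \<bar>D s\<bar> \<le> K * s"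
proof -
  obtain \<delta> where \<delta>: "\<delta> > 0" "\<And>s. 0 \<le> s \<Longrightarrow> s \<le> \<delta> \<Longrightarrow> \<bar>D s - s\<bar> \<le> 1 * s"
    using D_near_0[of 1] by auto
  have "bounded (D ` {0..M})"
    by (intro compact_imp_bounded compact_continuous_image continuous_on_subset[OF D_continuous]) auto
  then obtain C where C: "C > 0" "\<And>s. 0 \<le> s \<Longrightarrow> s \<le> M \<Longrightarrow> \<bar>D s\<bar> \<le> C"
    unfolding bounded_pos by auto
  have "\<bar>D s\<bar> \<le> (2 + C / \<delta>) * s" if s: "0 \<le> s" "s \<le> M" for s
  proof (cases "s \<le> \<delta>")
    case True
    then have "\<bar>D s\<bar> \<le> 2 * s" using \<delta>(2)[of s] s by linarith
    also have "\<dots> \<le> (2 + C / \<delta>) * s" using C \<delta> s by (intro mult_right_mono) auto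
    finally show ?thesis .
  next
    case False
    then have "C * \<delta> \<le> C * s" using C by (intro mult_left_mono) auto
    then have "C \<le> C / \<delta> * s" using \<delta>(1) by (simp add: field_simps)
    also have "\<dots> \<le> (2 + C / \<delta>) * s" using s by (intro mult_right_mono) auto
    finally show ?thesis using C(2)[OF s] by simp
  qed
  then show ?thesis using C \<delta> by (intro exI[of _ "2 + C / \<delta>"]) auto
qed

lemma standing_wave_bound:
  fixes v :: "real^'n::finite \<Rightarrow> real"
  assumes eq: "poisson_equation v (\<lambda>x. D (v x) - \<omega>\<^sup>2 * v x)"
    and v2: "integrable lborel (\<lambda>x. (v x)\<^sup>2)"
  shows "AE x in lborel. v x \<le> \<beta>\<^sub>0"
proof -
  interpret poisson_equation v "\<lambda>x. D (v x) - \<omega>\<^sup>2 * v x" by (rule eq)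
  \<comment> \<open>Values up to \<open>\<beta>\<^sub>0\<close> suffice for the lower bound on
    \<open>g\<close>, as \<open>D\<close> is nonnegative beyond. No upper bound on \<open>v\<close>
    is available at this stage.\<close>
  obtain K1 where K1: "K1 \<ge> 0" "\<And>s. 0 \<le> s \<Longrightarrow> s \<le> \<beta>\<^sub>0 \<Longrightarrow> \<bar>D s\<bar> \<le> K1 * s"
    using D_linear_bound[of \<beta>\<^sub>0] by auto
  define K where "K = K1 + \<omega>\<^sup>2"
  have K: "K \<ge> 0" using K1 by (simp add: K_def)
  have g_ge: "- K * v x \<le> D (v x) - \<omega>\<^sup>2 * v x" for x
  proof (cases "v x \<le> \<beta>\<^sub>0")
    case True
    then show ?thesis using K1(2)[OF v_nonneg, of x] by (simp add: K_def algebra_simps)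
  next
    case False
    then have "D (v x) \<ge> 0" using D_ge_id[of "v x"] v_nonneg[of x] by linarith
    moreover have "K1 * v x \<ge> 0" using K1 v_nonneg by simp
    ultimately show ?thesis by (simp add: K_def algebra_simps)
  qed
  then have g_ge': "AE x in lborel. - K * v x \<le> D (v x) - \<omega>\<^sup>2 * v x" by simp
  obtain B where B: "\<And>a. mean 1 a \<le> B" using mean_bounded[OF v2] by auto
  note limit = K g_ge' B
  define c where "c = mollifier_mass TYPE('n)"
  have c: "c > 0" by (simp add: c_def mollifier_mass_pos)
  have wv: "AE x in lborel. point_value x = c * v x"
    unfolding c_def by (rule point_value_AE_eq[OF limit])
  \<comment> \<open>A first essential bound on \<open>v\<close>, which depends on the solution; it
    serves only to bound \<open>D (v x)\<close> linearly, and thus \<open>g\<close> from both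
    sides.\<close>
  define M where "M = B * exp (K / 4) / c"
  have "AE x in lborel. v x \<le> M"
    using wv
  proof eventually_elim
    case (elim x)
    have "point_value x \<le> B * exp (K / 4)"
      by (rule order_trans[OF point_value_le_mean_1[OF limit] mult_right_mono[OF B]]) simp
    then show ?case using elim c by (simp add: M_def field_simps)
  qed
  moreover obtain K2 where K2: "K2 \<ge> 0" "\<And>s. 0 \<le> s \<Longrightarrow> s \<le> M \<Longrightarrow> \<bar>D s\<bar> \<le> K2 * s"
    using D_linear_bound[of M] by auto
  ultimately have D_bound: "AE x in lborel. \<bar>D (v x)\<bar> \<le> K2 * v x"
    by (auto elim!: eventually_mono intro: v_nonneg)
  define K' where "K' = K2 + \<omega>\<^sup>2"
  have K': "K' \<ge> 0" using K2 by (simp add: K'_def)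
  have g_le: "AE x in lborel. D (v x) - \<omega>\<^sup>2 * v x \<le> K' * v x"
    using D_bound
  proof eventually_elim
    case (elim x)
    moreover have "\<omega>\<^sup>2 * v x \<ge> 0" using v_nonneg by simp
    ultimately show ?case by (simp add: K'_def algebra_simps)
  qed
  have g_ge'': "AE x in lborel. - K' * v x \<le> D (v x) - \<omega>\<^sup>2 * v x"
    using D_bound by eventually_elim (simp add: K'_def algebra_simps)
  show ?thesis
  proof (cases "\<omega>\<^sup>2 \<le> 1")
    case True
    have "D s - \<omega>\<^sup>2 * s \<ge> 0" if "s > \<beta>\<^sub>0" for s
      using D_ge_id[OF that] mult_right_mono[OF True, of s] that \<beta>\<^sub>0_pos by linarith
    then show ?thesis
      by (intro maximum_principle[OF K' g_ge'' g_le v2 \<beta>\<^sub>0_pos]) simp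
  next
    case False
    \<comment> \<open>Half of the gap, so that
      \<open>(1 + \<epsilon>) - \<omega>\<^sup>2 = - \<epsilon>\<close>.\<close>
    define \<epsilon> where "\<epsilon> = (\<omega>\<^sup>2 - 1) / 2"
    have \<epsilon>: "\<epsilon> > 0" using False by (simp add: \<epsilon>_def)
    obtain \<delta> where \<delta>: "\<delta> > 0" "\<And>s. 0 \<le> s \<Longrightarrow> s \<le> \<delta> \<Longrightarrow> \<bar>D s - s\<bar> \<le> \<epsilon> * s"
      using D_near_0[OF \<epsilon>] by auto
    \<comment> \<open>Chosen so that a mean of at most \<open>\<eta>\<close> forces
      \<open>v \<le> \<delta>\<close> through \<open>point_value_le_mean_1\<close>.\<close>
    define \<eta> where "\<eta> = c * \<delta> * exp (- (K / 4))"
    have "\<eta> > 0" using c \<delta> by (simp add: \<eta>_def)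
    then obtain R where R: "\<And>a. norm a \<ge> R \<Longrightarrow> mean 1 a \<le> \<eta>"
      using mean_vanishes_at_infinity[OF v2] by auto
    have "AE x in lborel. norm x \<ge> R \<longrightarrow> D (v x) - \<omega>\<^sup>2 * v x \<le> - \<epsilon> * v x"
      using wv
    proof eventually_elim
      case (elim x)
      show ?case
      proof
        assume "norm x \<ge> R"
        have "point_value x \<le> mean 1 x * exp (K / 4)" by (rule point_value_le_mean_1[OF limit])
        also have "\<dots> \<le> \<eta> * exp (K / 4)" using R[OF \<open>norm x \<ge> R\<close>] by (intro mult_right_mono) auto
        also have "\<dots> = c * \<delta>" by (simp add: \<eta>_def mult.assoc flip: exp_add)
        finally have "v x \<le> \<delta>" using elim c by simp
        from \<delta>(2)[OF v_nonneg this] have "D (v x) \<le> (1 + \<epsilon>) * v x" by (simp add: algebra_simps)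
        moreover have "(1 + \<epsilon>) - \<omega>\<^sup>2 = - \<epsilon>" by (simp add: \<epsilon>_def field_simps)
        then have "(1 + \<epsilon>) * v x - \<omega>\<^sup>2 * v x = - \<epsilon> * v x" by (metis left_diff_distrib)
        ultimately show "D (v x) - \<omega>\<^sup>2 * v x \<le> - \<epsilon> * v x" by simp
      qed
    qed
    from vanishes_if_concave_at_infinity[OF K' g_le \<epsilon> this]
    show ?thesis by (rule AE_mp) (use \<beta>\<^sub>0_pos in auto)
  qed
qed

end

section \<open>Standing waves\<close>

lemma smooth_continuous:
  assumes "smooth \<phi>"
  shows "continuous_on UNIV \<phi>" and "smooth (partial i \<phi>)"
proof -
  have "\<phi> differentiable (at x)" for x
    using assms by (cases rule: smooth.cases) auto
  then show "continuous_on UNIV \<phi>"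
    by (intro continuous_at_imp_continuous_on ballI differentiable_imp_continuous_within)
  show "smooth (partial i \<phi>)"
    using assms by (cases rule: smooth.cases) auto
qed

lemma test_function_measurable:
  assumes "test_function \<phi>"
  shows "\<phi> \<in> borel_measurable borel" "laplacian \<phi> \<in> borel_measurable borel"
proof -
  have s: "smooth \<phi>" using assms by (simp add: test_function_def)
  show "\<phi> \<in> borel_measurable borel"
    by (intro borel_measurable_continuous_onI smooth_continuous s)
  show "laplacian \<phi> \<in> borel_measurable borel"
    unfolding laplacian_def[abs_def]
    by (intro borel_measurable_sum borel_measurable_continuous_onI smooth_continuous s)
qed

lemma integrable_test_function_mult:
  fixes f \<phi> :: "real^'n::finite \<Rightarrow> real"
  assumes \<phi>: "test_function \<phi>" and f: "\<And>K. compact K \<Longrightarrow> set_integrable lborel K f"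
  shows "integrable lborel (\<lambda>x. \<phi> x * f x)"
proof -
  let ?S = "closure {x. \<phi> x \<noteq> 0}"
  have S: "compact ?S" "continuous_on UNIV \<phi>"
    using \<phi> smooth_continuous by (auto simp: test_function_def)
  obtain R where R: "?S \<subseteq> ball 0 R"
    using bounded_subset_ballD[OF compact_imp_bounded[OF S(1)], of 0] by auto
  have "bounded (\<phi> ` ?S)"
    by (intro compact_imp_bounded compact_continuous_image S continuous_on_subset[OF S(2)]) simp
  then obtain B where B: "\<And>x. x \<in> ?S \<Longrightarrow> \<bar>\<phi> x\<bar> \<le> B"
    unfolding bounded_iff by auto
  have zero: "\<phi> x = 0" if "x \<notin> ?S" for x
    using that closure_subset[of "{x. \<phi> x \<noteq> 0}"] by blast
  show ?thesis
  proof (rule integrable_mult_compact_support[OF f[OF compact_cball[of 0 R]]])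
    show "\<bar>\<phi> x\<bar> \<le> max B 0" for x
      by (cases "x \<in> ?S") (use B[of x] zero[of x] in auto)
    show "\<phi> x = 0" if "dist 0 x \<ge> R" for x
      using that R by (intro zero) auto
  qed (rule test_function_measurable[OF \<phi>])
qed

lemma set_integrable_of_square_integrable:
  fixes f :: "'a::euclidean_space \<Rightarrow> real"
  assumes "compact K" "f \<in> borel_measurable borel" "integrable lborel (\<lambda>x. (f x)\<^sup>2)"
  shows "set_integrable lborel K f"
  unfolding set_integrable_def
proof (rule Bochner_Integration.integrable_bound)
  have K: "K \<in> sets borel" using assms(1) by (simp add: compact_imp_closed borel_closed)
  show "integrable lborel (\<lambda>x. indicat_real K x + (f x)\<^sup>2)"
    using assms K by (intro Bochner_Integration.integrable_add integrable_real_indicator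
        emeasure_bounded_finite compact_imp_bounded) auto
  show "(\<lambda>x. indicat_real K x *\<^sub>R f x) \<in> borel_measurable lborel"
    using assms K by measurable
  have "\<bar>f x\<bar> \<le> 1 + (f x)\<^sup>2" for x
    using zero_le_power2[of "\<bar>f x\<bar> - 1"] zero_le_power2[of "f x"]
    unfolding power2_diff power2_abs power_one mult_1_right by linarith
  then show "AE x in lborel. norm (indicat_real K x *\<^sub>R f x) \<le> norm (indicat_real K x + (f x)\<^sup>2)"
    by (intro AE_I2) (auto simp: indicator_def)
qed

lemma rep_cscale: "AE x in lborel. rep_L2 (cscale c \<psi>) x = c * rep_L2 \<psi> x"
proof -
  have "square_integrable (\<lambda>x. c * rep_L2 \<psi> x)"
    using rep_L2_square_integrable[of \<psi>]
    by (auto simp: square_integrable_def norm_mult power_mult_distrib)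
  then show ?thesis unfolding cscale_def by (rule rep_abs_L2)
qed

text \<open>Separates the phase \<open>c\<close> from the real profile, which makes the time
  dependence of all pairings explicit.\<close>

lemma pairing_cong_AE:
  fixes h :: "real^'n::finite \<Rightarrow> real"
  assumes "AE x in lborel. f x = c * of_real (h x)" "f \<in> borel_measurable borel" "h \<in> borel_measurable borel"
    "\<phi> \<in> borel_measurable borel"
  shows "pairing f \<phi> = c * of_real (LINT x|lborel. \<phi> x * h x)"
proof -
  have "pairing f \<phi> = (LINT x|lborel. c * of_real (\<phi> x * h x))"
    unfolding pairing_def
  proof (rule integral_cong_AE)
    show "AE x in lborel. \<phi> x *\<^sub>R f x = c * of_real (\<phi> x * h x)"
      using assms(1) by eventually_elim (simp add: scaleR_conv_of_real)
  qed (use assms in measurable)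
  then show ?thesis
    by (simp only: integral_mult_right_zero integral_complex_of_real)
qed

text \<open>The equation is integrated in time over the half period \<open>[0, \<pi> / \<omega>]\<close>, at the end points of
  which the phase takes the values \<open>1\<close> and \<open>- 1\<close>.\<close>

lemma (in nonlinearity) standing_wave_poisson_equation:
  fixes u :: "'n::finite L2"
  assumes nonneg: "AE x in lborel. rep_L2 u x \<in> \<real>\<^sub>\<ge>\<^sub>0" and \<omega>: "\<omega> > 0"
    and sol: "nkg_solution F (standing_wave u \<omega>)"
  shows "poisson_equation (\<lambda>x. cmod (rep_L2 u x))
    (\<lambda>x. D (cmod (rep_L2 u x)) - \<omega>\<^sup>2 * cmod (rep_L2 u x))"
proof -
  define v where "v x = cmod (rep_L2 u x)" for x
  define e where "e t = exp (- \<i> * \<omega> * t)" for t :: real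
  have e: "cmod (e t) = 1" "e t \<noteq> 0" for t by (auto simp: e_def norm_exp_eq_Re)
  have u_v: "AE x in lborel. rep_L2 u x = of_real (v x)"
    using nonneg by eventually_elim (auto simp: v_def nonneg_Reals_def)
  have rep_meas [measurable]: "rep_L2 \<psi> \<in> borel_measurable borel" for \<psi> :: "'n L2"
    using rep_L2_square_integrable[of \<psi>] by (auto simp: square_integrable_def)
  have v_sq: "integrable lborel (\<lambda>x. (v x)\<^sup>2)"
    using rep_L2_square_integrable[of u] by (auto simp: square_integrable_def v_def)
  have v_meas [measurable]: "v \<in> borel_measurable borel" unfolding v_def[abs_def] by measurable
  have D_meas: "(\<lambda>x. D (cmod (f x))) \<in> borel_measurable borel"
    if [measurable]: "f \<in> borel_measurable borel" for f :: "real^'n \<Rightarrow> complex"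
  proof -
    \<comment> \<open>Continuity of \<open>D\<close> is known on \<open>{0..}\<close> only;
      \<open>max 0\<close> extends it without changing its values at moduli.\<close>
    have "continuous_on UNIV (\<lambda>s. D (max 0 s))"
      by (rule continuous_on_compose2[OF D_continuous]) (auto intro!: continuous_intros)
    then have [measurable]: "(\<lambda>s. D (max 0 s)) \<in> borel_measurable borel"
      by (rule borel_measurable_continuous_onI)
    have "(\<lambda>x. D (max 0 (cmod (f x)))) \<in> borel_measurable borel" by measurable
    then show ?thesis by simp
  qed
  have Dv_meas [measurable]: "(\<lambda>x. D (v x)) \<in> borel_measurable borel"
    unfolding v_def by (rule D_meas) measurable
  let ?\<psi> = "standing_wave u \<omega>"
  have fst_AE: "AE x in lborel. rep_L2 (fst (?\<psi> t)) x = e t * of_real (v x)" for t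
    using rep_cscale[of "e t" u] u_v
    by eventually_elim (simp add: standing_wave_def e_def)
  have snd_AE: "AE x in lborel. rep_L2 (snd (?\<psi> t)) x = - \<i> * \<omega> * e t * of_real (v x)" for t
    using rep_cscale[of "- \<i> * \<omega> * e t" u] u_v
    by eventually_elim (simp add: standing_wave_def e_def)
  have pot_meas: "(\<lambda>x. potential_deriv F (rep_L2 (fst (?\<psi> t)) x)) \<in> borel_measurable borel" for t
    unfolding potential_deriv_def using D_meas[OF rep_meas, of "fst (?\<psi> t)"] by measurable
  \<comment> \<open>Where \<open>v x = 0\<close> the quotient in \<open>potential_deriv\<close> is
    \<open>0\<close> by convention, in agreement with \<open>D 0 = 0\<close>.\<close>
  have pot_AE: "AE x in lborel. potential_deriv F (rep_L2 (fst (?\<psi> t)) x) = e t * of_real (D (v x))" for t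
    using fst_AE[of t]
    by eventually_elim (simp add: potential_deriv_def norm_mult e v_def D_0)
  have v_loc: "set_integrable lborel K v" if "compact K" for K
    using that v_meas v_sq by (rule set_integrable_of_square_integrable)
  have Dv_loc: "set_integrable lborel K (\<lambda>x. D (v x))" if K: "compact K" for K
  proof -
    \<comment> \<open>Local integrability at a single time is enough: dividing by the phase removes
      the dependence on \<open>t\<close>.\<close>
    have "AE t in lborel. locally_integrable (\<lambda>x. potential_deriv F (rep_L2 (fst (?\<psi> t)) x))"
      using sol by (simp add: nkg_solution_def)
    moreover have "ae_filter (lborel :: real measure) \<noteq> bot"
      by (simp add: ae_filter_eq_bot_iff)
    ultimately obtain t where "locally_integrable (\<lambda>x. potential_deriv F (rep_L2 (fst (?\<psi> t)) x))"
      using eventually_happens' by blast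
    then have i: "integrable lborel (\<lambda>x. indicat_real K x *\<^sub>R potential_deriv F (rep_L2 (fst (?\<psi> t)) x))"
      using K by (simp add: locally_integrable_def set_integrable_def)
    have [measurable]: "K \<in> sets borel" using K by (simp add: compact_imp_closed borel_closed)
    have "integrable lborel (\<lambda>x. Re (inverse (e t) * (indicat_real K x *\<^sub>R potential_deriv F (rep_L2 (fst (?\<psi> t)) x))))"
      by (intro integrable_Re integrable_mult_right i)
    moreover have "(\<lambda>x. indicat_real K x *\<^sub>R D (v x)) \<in> borel_measurable lborel"
      by measurable
    moreover have "AE x in lborel. Re (inverse (e t) * (indicat_real K x *\<^sub>R potential_deriv F (rep_L2 (fst (?\<psi> t)) x)))
        = indicat_real K x *\<^sub>R D (v x)"
      using pot_AE[of t]
    proof eventually_elim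
      case (elim x)
      have "inverse (e t) * (indicat_real K x *\<^sub>R (e t * of_real (D (v x)))) = of_real (indicat_real K x * D (v x))"
        using e(2)[of t] by (simp add: scaleR_conv_of_real)
      then show ?case unfolding elim by simp
    qed
    ultimately show ?thesis
      unfolding set_integrable_def by (rule integrable_cong_AE_imp)
  qed
  have g_loc: "set_integrable lborel K (\<lambda>x. D (v x) - \<omega>\<^sup>2 * v x)" if "compact K" for K
    by (intro set_integral_diff set_integrable_mult_right Dv_loc v_loc that)
  have eq: "(LINT x|lborel. laplacian \<phi> x * v x) = (LINT x|lborel. \<phi> x * (D (v x) - \<omega>\<^sup>2 * v x))"
    if \<phi>: "test_function \<phi>" for \<phi>
  proof -
    note \<phi>_meas = test_function_measurable[OF \<phi>]
    define A where "A = (LINT x|lborel. laplacian \<phi> x * v x)"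
    define B where "B = (LINT x|lborel. \<phi> x * D (v x))"
    define P where "P = (LINT x|lborel. \<phi> x * v x)"
    define b where "b = pi / \<omega>"
    have b: "b \<ge> 0" using \<omega> by (simp add: b_def)
    have "e b = exp (- (\<i> * pi))" using \<omega> by (simp add: e_def b_def)
    then have eb: "e b = - 1" "e 0 = 1" by (auto simp: e_def exp_minus)
    have pair: "pairing (rep_L2 (fst (?\<psi> t))) (laplacian \<phi>) = e t * of_real A"
      "pairing (\<lambda>x. potential_deriv F (rep_L2 (fst (?\<psi> t)) x)) \<phi> = e t * of_real B"
      "pairing (rep_L2 (snd (?\<psi> t))) \<phi> = - \<i> * \<omega> * e t * of_real P" for t
      unfolding A_def B_def P_def
      by (rule pairing_cong_AE[OF fst_AE rep_meas v_meas \<phi>_meas(2)]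
          pairing_cong_AE[OF pot_AE pot_meas Dv_meas \<phi>_meas(1)]
          pairing_cong_AE[OF snd_AE rep_meas v_meas \<phi>_meas(1)])+
    have "has_bochner_integral (lebesgue_on {0..b}) (\<lambda>t. e t * (of_real A - of_real B))
        (- \<i> * \<omega> * e b * of_real P - (- \<i> * \<omega> * e 0 * of_real P))"
    proof -
      have "has_bochner_integral (lebesgue_on {0..b})
          (\<lambda>t. pairing (rep_L2 (fst (?\<psi> t))) (laplacian \<phi>)
               - pairing (\<lambda>x. potential_deriv F (rep_L2 (fst (?\<psi> t)) x)) \<phi>)
          (pairing (rep_L2 (snd (?\<psi> b))) \<phi> - pairing (rep_L2 (snd (?\<psi> 0))) \<phi>)"
        using sol \<phi> b by (simp only: nkg_solution_def)
      then show ?thesis by (simp only: pair right_diff_distrib)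
    qed
    then have h: "integrable (lebesgue_on {0..b}) (\<lambda>t. e t * (of_real A - of_real B))"
      "integral\<^sup>L (lebesgue_on {0..b}) (\<lambda>t. e t * (of_real A - of_real B)) = 2 * \<i> * \<omega> * P"
      by (auto simp: has_bochner_integral_iff eb)
    \<comment> \<open>An antiderivative in time, which evaluates the integral in \<open>h\<close> a
      second time. Equating the two values gives
      \<open>A = B - \<omega>\<^sup>2 * P\<close>.\<close>
    define G where "G t = e t * (of_real A - of_real B) / (- \<i> * \<omega>)" for t
    have "((\<lambda>t. e t * (of_real A - of_real B)) has_integral G b - G 0) {0..b}"
    proof (rule fundamental_theorem_of_calculus[OF b])
      fix t
      have "((\<lambda>z. exp (- \<i> * \<omega> * z) * (of_real A - of_real B) / (- \<i> * \<omega>)) has_field_derivative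
          exp (- \<i> * \<omega> * of_real t) * (of_real A - of_real B)) (at (of_real t))"
        using \<omega> by (auto intro!: derivative_eq_intros)
      then show "(G has_vector_derivative e t * (of_real A - of_real B)) (at t within {0..b})"
        unfolding G_def[abs_def] e_def by (rule has_vector_derivative_real_field)
    qed
    then have "integral {0..b} (\<lambda>t. e t * (of_real A - of_real B)) = G b - G 0"
      by (rule integral_unique)
    then have "2 * \<i> * \<omega> * P = G b - G 0"
      using lebesgue_integral_eq_integral[OF h(1)] h(2) by simp
    also have "\<dots> = 2 * (of_real A - of_real B) / (\<i> * \<omega>)"
      by (simp add: G_def eb diff_divide_distrib)
    finally have "(2 * \<i> * \<omega> * P) * (\<i> * \<omega>) = 2 * (of_real A - of_real B)"
      using \<omega> by (simp add: nonzero_eq_divide_eq)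
    then have "complex_of_real (- (2 * (\<omega>\<^sup>2 * P))) = of_real (2 * (A - B))"
      by (simp add: power2_eq_square algebra_simps)
    then have "- (2 * (\<omega>\<^sup>2 * P)) = 2 * (A - B)"
      by (simp only: of_real_eq_iff)
    then have "A = B - \<omega>\<^sup>2 * P" by simp
    also have "\<dots> = (LINT x|lborel. \<phi> x * D (v x) - \<omega>\<^sup>2 * (\<phi> x * v x))"
      using integrable_test_function_mult[OF \<phi> Dv_loc] integrable_test_function_mult[OF \<phi> v_loc]
      by (simp add: B_def P_def)
    finally show ?thesis by (simp add: A_def algebra_simps)
  qed
  have "poisson_equation v (\<lambda>x. D (v x) - \<omega>\<^sup>2 * v x)"
  proof
    show "v x \<ge> 0" for x by (simp add: v_def)
  qed (simp_all add: v_meas v_loc g_loc eq)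
  then show ?thesis unfolding v_def[abs_def] .
qed

theorem theorem4p13:
  fixes F :: "real \<Rightarrow> real"
    and U :: "real \<Rightarrow> 'n::finite state \<Rightarrow> 'n state"
    and \<beta>\<^sub>0 :: real
  assumes "CARD('n) \<ge> 2"
    and "smooth_plus F"
    and "W_i F" and "W_ii F" and "W_iii F"
    and "time_evolution F U"
    and "\<beta>\<^sub>0 > 0"
    and "\<forall>s>\<beta>\<^sub>0. deriv_plus (nonlinear_part F) s \<ge> 0"
  shows "type_beta F U"
  unfolding type_beta_def
proof (intro exI[of _ \<beta>\<^sub>0] conjI allI impI)
  interpret nonlinearity F \<beta>\<^sub>0
    using assms by unfold_locales
  fix u :: "'n L2" and \<omega> t :: real
  assume "hylomorphic_standing_wave F U u \<omega>"
  then have u: "AE x in lborel. rep_L2 u x \<in> \<real>\<^sub>\<ge>\<^sub>0" "\<omega> > 0" "nkg_solution F (standing_wave u \<omega>)"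
    by (auto simp: hylomorphic_standing_wave_def)
  have "AE x in lborel. cmod (rep_L2 u x) \<le> \<beta>\<^sub>0"
    by (rule standing_wave_bound[OF standing_wave_poisson_equation[OF u]])
       (use rep_L2_square_integrable[of u] in \<open>simp add: square_integrable_def\<close>)
  then have "AE x in lborel. ereal (cmod (rep_L2 (fst (standing_wave u \<omega> t)) x)) \<le> ereal \<beta>\<^sub>0"
    using rep_cscale[of "exp (- \<i> * \<omega> * t)" u]
    by eventually_elim (simp add: standing_wave_def norm_mult norm_exp_eq_Re)
  moreover have "rep_L2 (fst (standing_wave u \<omega> t)) \<in> borel_measurable lborel"
    using rep_L2_square_integrable[of "fst (standing_wave u \<omega> t)"] by (simp add: square_integrable_def)
  moreover from this have "(\<lambda>x. ereal (cmod (rep_L2 (fst (standing_wave u \<omega> t)) x))) \<in> borel_measurable lborel"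
    by measurable
  ultimately show "Linf_norm (fst (standing_wave u \<omega> t)) \<le> ereal \<beta>\<^sub>0"
    unfolding Linf_norm_def by (intro esssup_I)
qed (use assms in auto)

end
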